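(* For each of the groups $\mathbb{Z}/15\mathbb{Z}\oplus\mathbb{Z}$, $\mathbb{Z}/18\mathbb{Z}\oplus\mathbb{Z}^2$, $\mathbb{Z}/2\mathbb{Z}\oplus\mathbb{Z}/10\mathbb{Z}\oplus\mathbb{Z}^4$, and $\mathbb{Z}/2\mathbb{Z}\oplus\mathbb{Z}/12\mathbb{Z}\oplus\mathbb{Z}^4$, there exist a quadratic number field $K$ and an elliptic curve $E$ over $K$ whose Mordell--Weil group $E(K)$ contains a subgroup isomorphic to that group. *)

theory Defs
  imports
    Complex_Main
    "HOL-Algebra.Algebraic_Closure_Type"
    "HOL-Algebra.Elementary_Groups"
    "HOL-Algebra.Product_Groups"
begin

text \<open>
  Every number field embeds into the complex numbers, so number fields are taken to be subfields
  of \<^typ>\<open>complex\<close>; \<^const>\<open>ring_of_type_algebra\<close> is the type viewed as a ring record.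
\<close>

definition quadratic_number_field :: "complex set \<Rightarrow> bool" where
  "quadratic_number_field K \<longleftrightarrow>
     subfield K ring_of_type_algebra \<and> ring.dimension ring_of_type_algebra 2 \<rat> K"

text \<open>
  The Weierstrass equation
  \<open>y\<^sup>2 + a\<^sub>1 x y + a\<^sub>3 y = x\<^sup>3 + a\<^sub>2 x\<^sup>2 + a\<^sub>4 x + a\<^sub>6\<close>
  is represented by its coefficients.
\<close>

datatype 'a weierstrass =
  Weierstrass (a\<^sub>1: 'a) (a\<^sub>2: 'a) (a\<^sub>3: 'a) (a\<^sub>4: 'a) (a\<^sub>6: 'a)

definition discriminant :: "'a::field weierstrass \<Rightarrow> 'a" where
  "discriminant E =
     (let b\<^sub>2 = (a\<^sub>1 E)\<^sup>2 + 4 * a\<^sub>2 E;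
          b\<^sub>4 = 2 * a\<^sub>4 E + a\<^sub>1 E * a\<^sub>3 E;
          b\<^sub>6 = (a\<^sub>3 E)\<^sup>2 + 4 * a\<^sub>6 E;
          b\<^sub>8 = (a\<^sub>1 E)\<^sup>2 * a\<^sub>6 E + 4 * a\<^sub>2 E * a\<^sub>6 E - a\<^sub>1 E * a\<^sub>3 E * a\<^sub>4 E
                + a\<^sub>2 E * (a\<^sub>3 E)\<^sup>2 - (a\<^sub>4 E)\<^sup>2
      in - (b\<^sub>2\<^sup>2 * b\<^sub>8) - 8 * b\<^sub>4 ^ 3 - 27 * b\<^sub>6\<^sup>2 + 9 * b\<^sub>2 * b\<^sub>4 * b\<^sub>6)"

definition elliptic_curve_over :: "'a::field set \<Rightarrow> 'a weierstrass \<Rightarrow> bool" where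
  "elliptic_curve_over K E \<longleftrightarrow>
     {a\<^sub>1 E, a\<^sub>2 E, a\<^sub>3 E, a\<^sub>4 E, a\<^sub>6 E} \<subseteq> K \<and> discriminant E \<noteq> 0"

datatype 'a point = Infinity | Affine 'a 'a

fun on_curve :: "'a::field weierstrass \<Rightarrow> 'a point \<Rightarrow> bool" where
  "on_curve E Infinity \<longleftrightarrow> True"
| "on_curve E (Affine x y) \<longleftrightarrow>
     y\<^sup>2 + a\<^sub>1 E * x * y + a\<^sub>3 E * y = x ^ 3 + a\<^sub>2 E * x\<^sup>2 + a\<^sub>4 E * x + a\<^sub>6 E"

text \<open>
  The chord-and-tangent law. The first test says that the two points are opposite, since
  the negative of \<open>(x, y)\<close> is \<open>(x, - y - a\<^sub>1 x - a\<^sub>3)\<close>. Otherwise \<open>l\<close> is the slope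
  of the chord, or of the tangent line if the points coincide.
\<close>

fun point_add :: "'a::field weierstrass \<Rightarrow> 'a point \<Rightarrow> 'a point \<Rightarrow> 'a point" where
  "point_add E Infinity Q = Q"
| "point_add E P Infinity = P"
| "point_add E (Affine x\<^sub>1 y\<^sub>1) (Affine x\<^sub>2 y\<^sub>2) =
     (if x\<^sub>1 = x\<^sub>2 \<and> y\<^sub>1 + y\<^sub>2 + a\<^sub>1 E * x\<^sub>2 + a\<^sub>3 E = 0 then Infinity
      else
        let l = (if x\<^sub>1 = x\<^sub>2
                 then (3 * x\<^sub>1\<^sup>2 + 2 * a\<^sub>2 E * x\<^sub>1 + a\<^sub>4 E - a\<^sub>1 E * y\<^sub>1) / (2 * y\<^sub>1 + a\<^sub>1 E * x\<^sub>1 + a\<^sub>3 E)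
                 else (y\<^sub>2 - y\<^sub>1) / (x\<^sub>2 - x\<^sub>1));
            x\<^sub>3 = l\<^sup>2 + a\<^sub>1 E * l - a\<^sub>2 E - x\<^sub>1 - x\<^sub>2
        in Affine x\<^sub>3 (- (y\<^sub>1 + l * (x\<^sub>3 - x\<^sub>1)) - a\<^sub>1 E * x\<^sub>3 - a\<^sub>3 E))"

definition mordell_weil_group :: "'a::field weierstrass \<Rightarrow> 'a set \<Rightarrow> 'a point monoid" where
  "mordell_weil_group E K =
     \<lparr>carrier = {P. on_curve E P \<and> set_point P \<subseteq> K},
      monoid.mult = point_add E,
      one = Infinity\<rparr>"

definition has_subgroup_isomorphic_to ::
    "('a, 'c) monoid_scheme \<Rightarrow> ('b, 'd) monoid_scheme \<Rightarrow> bool" where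
  "has_subgroup_isomorphic_to M G \<longleftrightarrow> (\<exists>H. subgroup H M \<and> M\<lparr>carrier := H\<rparr> \<cong> G)"

abbreviation free_abelian_group_of_rank :: "nat \<Rightarrow> (nat \<Rightarrow> int) monoid" where
  "free_abelian_group_of_rank r \<equiv> product_group {..<r} (\<lambda>_. integer_group)"

end

theory Submission
  imports Defs "HOL-Number_Theory.Number_Theory"
begin

text \<open>
  Each group is found on an explicit curve \<open>y\<^sup>2 = x\<^sup>3 + a x\<^sup>2 + b x + c\<close> over an explicit
  quadratic field. If \<open>t\<^sub>1, \<dots>, t\<^sub>l, g\<^sub>1, \<dots>, g\<^sub>r\<close> in an abelian group \<open>A\<close> are independent
  modulo \<open>2A\<close> and the \<open>t\<^sub>i\<close> generate \<open>A[2]\<close>, then the \<open>g\<^sub>j\<close> generate a free group of rank \<open>r\<close>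
  that meets the torsion trivially. Independence is witnessed by characters \<open>A/2A \<rightarrow> {\<plusminus>1}\<close>:
  for a root \<open>e\<close> of the cubic, \<open>x - e\<close> is a homomorphism to the square classes of the field, and at a
  prime that splits in the field a Legendre symbol decides whether its value is a local square. Where
  these characters do not suffice, a point is not in \<open>2A\<close> because the quartic for halving it has no
  root modulo a split prime.
\<close>

section \<open>The group law\<close>

locale elliptic_curve =
  fixes a1 a2 a3 a4 a6 :: "'a::field"
  assumes discriminant_nonzero: "discriminant (Weierstrass a1 a2 a3 a4 a6) \<noteq> 0"
begin

abbreviation "E \<equiv> Weierstrass a1 a2 a3 a4 a6"

lemma nonsingular:
  assumes on: "on_curve E (Affine x y)" and dy: "2 * y + a1 * x + a3 = 0"
  shows "3 * x\<^sup>2 + 2 * a2 * x + a4 - a1 * y \<noteq> 0"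
proof
  assume dx: "3 * x\<^sup>2 + 2 * a2 * x + a4 - a1 * y = 0"
  define b2 where "b2 = a1\<^sup>2 + 4 * a2"
  have eq: "y\<^sup>2 + a1 * x * y + a3 * y = x ^ 3 + a2 * x\<^sup>2 + a4 * x + a6"
    using on by simp
  have b4: "2 * a4 + a1 * a3 = - 6 * x\<^sup>2 - b2 * x"
    using dx dy unfolding b2_def by Groebner_Basis.algebra
  have b6: "a3\<^sup>2 + 4 * a6 = 8 * x ^ 3 + b2 * x\<^sup>2"
    using dx dy eq unfolding b2_def by Groebner_Basis.algebra
  have b8: "a1\<^sup>2 * a6 + 4 * a2 * a6 - a1 * a3 * a4 + a2 * a3\<^sup>2 - a4\<^sup>2 = - 9 * x ^ 4 - b2 * x ^ 3"
    using dx dy eq unfolding b2_def by Groebner_Basis.algebra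
  have "discriminant E = - (b2\<^sup>2 * (- 9 * x ^ 4 - b2 * x ^ 3)) - 8 * (- 6 * x\<^sup>2 - b2 * x) ^ 3
      - 27 * (8 * x ^ 3 + b2 * x\<^sup>2)\<^sup>2 + 9 * b2 * (- 6 * x\<^sup>2 - b2 * x) * (8 * x ^ 3 + b2 * x\<^sup>2)"
    by (simp add: discriminant_def Let_def b4 b6 b8 flip: b2_def)
  also have "\<dots> = 0" by Groebner_Basis.algebra
  finally show False using discriminant_nonzero by simp
qed

primrec neg_point :: "'a point \<Rightarrow> 'a point" where
  "neg_point Infinity = Infinity"
| "neg_point (Affine x y) = Affine x (- y - a1 * x - a3)"

definition slope :: "'a \<Rightarrow> 'a \<Rightarrow> 'a \<Rightarrow> 'a \<Rightarrow> 'a" where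
  "slope x1 y1 x2 y2 =
     (if x1 = x2 then (3 * x1\<^sup>2 + 2 * a2 * x1 + a4 - a1 * y1) / (2 * y1 + a1 * x1 + a3)
      else (y2 - y1) / (x2 - x1))"

text \<open>
  The line \<open>y = l x + m\<close> meets the curve at the abscissas \<open>x1, x2, x3\<close>, counted with multiplicity: the
  coefficients of the resulting cubic are compared, so that tangents need no separate treatment.
\<close>

definition line_meets :: "'a \<Rightarrow> 'a \<Rightarrow> 'a \<Rightarrow> 'a \<Rightarrow> 'a \<Rightarrow> bool" where
  "line_meets l m x1 x2 x3 \<longleftrightarrow>
     x1 + x2 + x3 = l\<^sup>2 + a1 * l - a2 \<and>
     x1 * x2 + x1 * x3 + x2 * x3 = a4 - 2 * l * m - a1 * m - a3 * l \<and>
     x1 * x2 * x3 = m\<^sup>2 + a3 * m - a6"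

lemma line_meets_permute:
  assumes "line_meets l m x1 x2 x3"
  shows "line_meets l m x2 x1 x3" "line_meets l m x1 x3 x2" "line_meets l m x2 x3 x1"
    "line_meets l m x3 x1 x2"
  using assms by (auto simp: line_meets_def algebra_simps)

lemma line_meets_factor:
  assumes "line_meets l m x1 x2 x3" "y = l * x + m"
  shows "y\<^sup>2 + a1 * x * y + a3 * y - (x ^ 3 + a2 * x\<^sup>2 + a4 * x + a6) = - (x - x1) * (x - x2) * (x - x3)"
  using assms unfolding line_meets_def by Groebner_Basis.algebra

lemma line_meets_derivative:
  assumes "line_meets l m x1 x2 x3" "y = l * x + m"
  shows "3 * x\<^sup>2 + 2 * a2 * x + a4 - a1 * y =
    l * (2 * y + a1 * x + a3) + (x - x1) * (x - x2) + (x - x1) * (x - x3) + (x - x2) * (x - x3)"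
  using assms unfolding line_meets_def by Groebner_Basis.algebra

lemma slope_eq_if_line_meets:
  assumes meets: "line_meets l m x1 x2 x3"
  shows "slope x1 (l * x1 + m) x2 (l * x2 + m) = l"
    and "\<not> (x1 = x2 \<and> (l * x1 + m) + (l * x2 + m) + a1 * x2 + a3 = 0)"
proof -
  define y where "y = l * x1 + m"
  have "on_curve E (Affine x1 y)"
    using line_meets_factor[OF meets y_def] by simp
  moreover have derivative: "3 * x1\<^sup>2 + 2 * a2 * x1 + a4 - a1 * y = l * (2 * y + a1 * x1 + a3)" if "x1 = x2"
    using line_meets_derivative[OF meets y_def] that by simp
  ultimately have nonzero: "2 * y + a1 * x1 + a3 \<noteq> 0" if "x1 = x2"
    using nonsingular[of x1 y] that by auto
  show "slope x1 (l * x1 + m) x2 (l * x2 + m) = l"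
  proof (cases "x1 = x2")
    case True
    then have "(3 * x1\<^sup>2 + 2 * a2 * x1 + a4 - a1 * y) / (2 * y + a1 * x1 + a3) = l"
      using derivative nonzero by simp
    with True show ?thesis by (simp add: slope_def y_def)
  next
    case False
    then show ?thesis by (simp add: slope_def field_simps)
  qed
  have "(l * x1 + m) + (l * x2 + m) + a1 * x2 + a3 = 2 * y + a1 * x1 + a3" if "x1 = x2"
    using that by (simp add: y_def)
  with nonzero show "\<not> (x1 = x2 \<and> (l * x1 + m) + (l * x2 + m) + a1 * x2 + a3 = 0)" by metis
qed

lemma point_add_slope:
  assumes "\<not> (x1 = x2 \<and> y1 + y2 + a1 * x2 + a3 = 0)"
    and "l = slope x1 y1 x2 y2" "x3 = l\<^sup>2 + a1 * l - a2 - x1 - x2"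
  shows "point_add E (Affine x1 y1) (Affine x2 y2) = neg_point (Affine x3 (y1 + l * (x3 - x1)))"
  using assms by (auto simp: slope_def Let_def)

lemma point_add_opposite: "point_add E P (neg_point P) = Infinity"
  by (cases P) (simp_all add: algebra_simps)

lemma point_add_if_line_meets:
  assumes "line_meets l m x1 x2 x3"
  shows "point_add E (Affine x1 (l * x1 + m)) (Affine x2 (l * x2 + m)) = neg_point (Affine x3 (l * x3 + m))"
proof -
  have "x3 = l\<^sup>2 + a1 * l - a2 - x1 - x2" using assms by (simp add: line_meets_def algebra_simps)
  then show ?thesis
    using point_add_slope[OF slope_eq_if_line_meets(2)[OF assms] slope_eq_if_line_meets(1)[OF assms, symmetric]]
    by (simp add: algebra_simps)
qed

declare point_add.simps(3) [simp del]

lemma y_eq_or_opposite: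
  assumes "on_curve E (Affine x y)" "on_curve E (Affine x y')"
  shows "y' = y \<or> Affine x y' = neg_point (Affine x y)"
proof -
  have "(y - y') * (y + y' + a1 * x + a3) = 0" using assms by (simp add: algebra_simps power2_eq_square)
  then consider (same) "y' = y" | (opposite) "y + y' + a1 * x + a3 = 0" by auto
  then show ?thesis
  proof cases
    case opposite
    have "y' = (y + y' + a1 * x + a3) - y - a1 * x - a3" by simp
    also have "\<dots> = - y - a1 * x - a3" unfolding opposite by simp
    finally show ?thesis by simp
  qed simp
qed

lemma line_meets_slope:
  assumes on: "on_curve E (Affine x1 y1)" "on_curve E (Affine x2 y2)"
    and not_opposite: "Affine x2 y2 \<noteq> neg_point (Affine x1 y1)"
    and l: "l = slope x1 y1 x2 y2"
  shows "line_meets l (y1 - l * x1) x1 x2 (l\<^sup>2 + a1 * l - a2 - x1 - x2)"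
    and "y2 = l * x2 + (y1 - l * x1)"
proof -
  define m x3 where "m = y1 - l * x1" and "x3 = l\<^sup>2 + a1 * l - a2 - x1 - x2"
  have on1: "y1\<^sup>2 + a1 * x1 * y1 + a3 * y1 = x1 ^ 3 + a2 * x1\<^sup>2 + a4 * x1 + a6"
    and on2: "y2\<^sup>2 + a1 * x2 * y2 + a3 * y2 = x2 ^ 3 + a2 * x2\<^sup>2 + a4 * x2 + a6"
    using on by simp_all
  have y1: "y1 = l * x1 + m" by (simp add: m_def)
  have "y2 = l * x2 + m \<and> x1 * x2 + x1 * x3 + x2 * x3 = a4 - 2 * l * m - a1 * m - a3 * l"
  proof (cases "x1 = x2")
    case True
    then have y2: "y2 = y1" using y_eq_or_opposite on not_opposite by blast
    then have "2 * y1 + a1 * x1 + a3 \<noteq> 0"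
      using not_opposite True by (auto simp: algebra_simps eq_neg_iff_add_eq_0)
    then have "l * (2 * y1 + a1 * x1 + a3) = 3 * x1\<^sup>2 + 2 * a2 * x1 + a4 - a1 * y1"
      using True l by (simp add: slope_def)
    then have "x1 * x2 + x1 * x3 + x2 * x3 = a4 - 2 * l * m - a1 * m - a3 * l"
      using True x3_def y1 by Groebner_Basis.algebra
    with True y1 y2 show ?thesis by simp
  next
    case False
    then have "l * (x2 - x1) = y2 - y1" using l by (simp add: slope_def)
    then have y2: "y2 = l * x2 + m" by (simp add: m_def algebra_simps)
    have "(x1 - x2) * (x1 * x2 + x1 * x3 + x2 * x3) = (x1 - x2) * (a4 - 2 * l * m - a1 * m - a3 * l)"
      using on1 on2 y1 y2 x3_def by Groebner_Basis.algebra
    with False y2 show ?thesis by simp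
  qed
  moreover from this have "x1 * x2 * x3 = m\<^sup>2 + a3 * m - a6"
    using on1 y1 x3_def by Groebner_Basis.algebra
  ultimately show "line_meets l (y1 - l * x1) x1 x2 (l\<^sup>2 + a1 * l - a2 - x1 - x2)"
    and "y2 = l * x2 + (y1 - l * x1)"
    by (simp_all add: line_meets_def x3_def m_def)
qed

lemma on_curve_neg_point: "on_curve E P \<Longrightarrow> on_curve E (neg_point P)"
  by (cases P) (simp_all add: power2_eq_square algebra_simps)

lemma neg_point_neg_point [simp]: "neg_point (neg_point P) = P"
  by (cases P) simp_all

lemma point_add_cases:
  assumes "on_curve E P" "on_curve E Q"
  obtains (left_zero) "P = Infinity" | (right_zero) "Q = Infinity" | (opposite) "Q = neg_point P"
    | (line) l m x1 x2 x3 where "line_meets l m x1 x2 x3"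
        "P = Affine x1 (l * x1 + m)" "Q = Affine x2 (l * x2 + m)"
        "point_add E P Q = neg_point (Affine x3 (l * x3 + m))"
proof (cases P; cases Q)
  fix x1 y1 x2 y2 assume PQ: "P = Affine x1 y1" "Q = Affine x2 y2"
  show thesis
  proof (cases "Q = neg_point P")
    case False
    define l where "l = slope x1 y1 x2 y2"
    have meets: "line_meets l (y1 - l * x1) x1 x2 (l\<^sup>2 + a1 * l - a2 - x1 - x2)" "y2 = l * x2 + (y1 - l * x1)"
      using line_meets_slope[OF _ _ _ l_def] assms PQ False by blast+
    have "P = Affine x1 (l * x1 + (y1 - l * x1))" using PQ by simp
    then show ?thesis using meets PQ point_add_if_line_meets[OF meets(1)] by (intro line) auto
  qed (rule opposite)
qed (use left_zero right_zero in auto)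

lemma point_add_Infinity_right [simp]: "point_add E P Infinity = P"
  by (cases P) simp_all

lemma point_add_commute:
  assumes "on_curve E P" "on_curve E Q"
  shows "point_add E P Q = point_add E Q P"
  using assms
proof (cases rule: point_add_cases)
  case opposite
  then show ?thesis using point_add_opposite[of P] point_add_opposite[of Q] by simp
next
  case (line l m x1 x2 x3)
  then show ?thesis using point_add_if_line_meets[OF line_meets_permute(1)[OF line(1)]] by simp
qed simp_all

lemma on_curve_line_meets:
  assumes "line_meets l m x1 x2 x3"
  shows "on_curve E (Affine x3 (l * x3 + m))"
  using line_meets_factor[OF assms refl, of x3] by simp

lemma on_curve_point_add:
  assumes "on_curve E P" "on_curve E Q"
  shows "on_curve E (point_add E P Q)"
  using assms
proof (cases rule: point_add_cases)
  case (line l m x1 x2 x3)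
  then show ?thesis using on_curve_line_meets on_curve_neg_point by metis
qed (use assms in \<open>simp_all add: point_add_opposite\<close>)

lemma line_meets_neg:
  assumes "line_meets l m x1 x2 x3"
  shows "line_meets (- l - a1) (- m - a3) x1 x2 x3"
  using assms by (simp add: line_meets_def power2_eq_square algebra_simps)

lemma point_add_neg_cancel:
  assumes "on_curve E P" "on_curve E Q"
  shows "point_add E (neg_point P) (point_add E P Q) = Q"
  using assms
proof (cases rule: point_add_cases)
  case right_zero
  then show ?thesis
    using point_add_opposite[of "neg_point P"] point_add_commute assms on_curve_neg_point by simp
next
  case (line l m x1 x2 x3)
  have neg: "Affine x ((- l - a1) * x + (- m - a3)) = neg_point (Affine x (l * x + m))" for x
    by (simp add: algebra_simps)
  show ?thesis
    using point_add_if_line_meets[OF line_meets_permute(2)[OF line_meets_neg[OF line(1)]]]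
    unfolding neg by (simp only: line(4) neg_point_neg_point flip: line(2,3))
qed (simp_all add: point_add_opposite)

text \<open>
  Similarly for the parabola \<open>y = k x\<^sup>2 + l x + m\<close> and four points. The secants of the parabola through two
  complementary pairs of them meet the curve again in opposite points, so \<open>(P\<^sub>1 + P\<^sub>2) + P\<^sub>3 = - P\<^sub>4\<close>. The
  symmetry of the right-hand side yields associativity.
\<close>

definition parabola_meets :: "'a \<Rightarrow> 'a \<Rightarrow> 'a \<Rightarrow> 'a \<Rightarrow> 'a \<Rightarrow> 'a \<Rightarrow> 'a \<Rightarrow> bool" where
  "parabola_meets k l m x1 x2 x3 x4 \<longleftrightarrow>
     2 * k * l + a1 * k - 1 = - k\<^sup>2 * (x1 + x2 + x3 + x4) \<and>
     l\<^sup>2 + 2 * k * m + a1 * l + a3 * k - a2 =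
       k\<^sup>2 * (x1 * x2 + x1 * x3 + x1 * x4 + x2 * x3 + x2 * x4 + x3 * x4) \<and>
     2 * l * m + a1 * m + a3 * l - a4 =
       - k\<^sup>2 * (x1 * x2 * x3 + x1 * x2 * x4 + x1 * x3 * x4 + x2 * x3 * x4) \<and>
     m\<^sup>2 + a3 * m - a6 = k\<^sup>2 * (x1 * x2 * x3 * x4)"

lemma parabola_meets_permute:
  assumes "parabola_meets k l m x1 x2 x3 x4"
  shows "parabola_meets k l m x2 x3 x1 x4" "parabola_meets k l m x3 x4 x1 x2"
  using assms by (simp_all add: parabola_meets_def ac_simps)

lemma secant_third_point:
  assumes "parabola_meets k l m x1 x2 x3 x4" and "l' = l + k * (x1 + x2)"
  shows "l'\<^sup>2 + a1 * l' - a2 - x1 - x2 = l\<^sup>2 + a1 * l - a2 - k\<^sup>2 * (x1 + x2) * (x3 + x4)"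
proof -
  have "l'\<^sup>2 + a1 * l' - a2 - x1 - x2 =
      l\<^sup>2 + a1 * l - a2 + (x1 + x2) * (2 * k * l + a1 * k - 1 + k\<^sup>2 * (x1 + x2))"
    unfolding assms(2) by (simp add: power2_eq_square algebra_simps)
  also have "2 * k * l + a1 * k - 1 + k\<^sup>2 * (x1 + x2) = - k\<^sup>2 * (x3 + x4)"
    using assms(1) unfolding parabola_meets_def by Groebner_Basis.algebra
  finally show ?thesis by (simp add: algebra_simps)
qed

lemma line_meets_secant:
  assumes meets: "parabola_meets k l m x1 x2 x3 x4"
    and l': "l' = l + k * (x1 + x2)" and m': "m' = m - k * x1 * x2"
  shows "line_meets l' m' x1 x2 (l\<^sup>2 + a1 * l - a2 - k\<^sup>2 * (x1 + x2) * (x3 + x4))"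
proof -
  define s p t q where "s = x1 + x2" and "p = x1 * x2" and "t = x3 + x4" and "q = x3 * x4"
  have degree3: "2 * k * l + a1 * k - 1 = - k\<^sup>2 * (s + t)"
    and degree2: "l\<^sup>2 + 2 * k * m + a1 * l + a3 * k - a2 = k\<^sup>2 * (p + q + s * t)"
    and degree1: "2 * l * m + a1 * m + a3 * l - a4 = - k\<^sup>2 * (p * t + q * s)"
    and degree0: "m\<^sup>2 + a3 * m - a6 = k\<^sup>2 * (p * q)"
    using meets unfolding parabola_meets_def s_def p_def t_def q_def by Groebner_Basis.algebra+
  define x where "x = l\<^sup>2 + a1 * l - a2 - k\<^sup>2 * s * t"
  have "p + s * x = a4 - 2 * l' * m' - a1 * m' - a3 * l'" "p * x = m'\<^sup>2 + a3 * m' - a6"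
    using degree3 degree2 degree1 degree0 x_def l'[folded s_def] m'[unfolded mult.assoc, folded p_def]
    by Groebner_Basis.algebra+
  then show ?thesis
    using secant_third_point[OF meets l'] unfolding line_meets_def x_def s_def p_def t_def
    by (simp add: algebra_simps)
qed

lemma secants_meet_in_opposite_points:
  assumes meets: "parabola_meets k l m x1 x2 x3 x4" and k: "k \<noteq> 0"
    and l1: "l1 = l + k * (x1 + x2)" and m1: "m1 = m - k * x1 * x2"
    and l2: "l2 = l + k * (x3 + x4)" and m2: "m2 = m - k * x3 * x4"
    and x: "x = l\<^sup>2 + a1 * l - a2 - k\<^sup>2 * (x1 + x2) * (x3 + x4)"
  shows "l2 * x + m2 = - (l1 * x + m1) - a1 * x - a3"
proof -
  have "k * (l1 + l2 + a1) = 1"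
    using meets l1 l2 unfolding parabola_meets_def by Groebner_Basis.algebra
  moreover have "x + k * (m1 + m2 + a3) = 0"
    using meets m1 m2 x unfolding parabola_meets_def by Groebner_Basis.algebra
  ultimately have "k * ((l2 * x + m2) - (- (l1 * x + m1) - a1 * x - a3)) = 0"
    by Groebner_Basis.algebra
  with k show ?thesis by simp
qed

lemma point_add_parabola:
  assumes meets: "parabola_meets k l m x1 x2 x3 x4" and k: "k \<noteq> 0"
    and y: "y1 = k * x1\<^sup>2 + l * x1 + m" "y2 = k * x2\<^sup>2 + l * x2 + m" "y3 = k * x3\<^sup>2 + l * x3 + m"
  shows "point_add E (point_add E (Affine x1 y1) (Affine x2 y2)) (Affine x3 y3) =
    neg_point (Affine x4 (k * x4\<^sup>2 + l * x4 + m))"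
proof -
  define l1 m1 where "l1 = l + k * (x1 + x2)" and "m1 = m - k * x1 * x2"
  define l2 m2 where "l2 = l + k * (x3 + x4)" and "m2 = m - k * x3 * x4"
  define x where "x = l\<^sup>2 + a1 * l - a2 - k\<^sup>2 * (x1 + x2) * (x3 + x4)"
  have meets12: "line_meets l1 m1 x1 x2 x"
    unfolding x_def using meets l1_def m1_def by (rule line_meets_secant)
  have "x = l\<^sup>2 + a1 * l - a2 - k\<^sup>2 * (x3 + x4) * (x1 + x2)" by (simp add: x_def)
  then have meets34: "line_meets l2 m2 x3 x4 x"
    using line_meets_secant[OF parabola_meets_permute(2)[OF meets] l2_def m2_def] by simp
  have y': "y1 = l1 * x1 + m1" "y2 = l1 * x2 + m1" "y3 = l2 * x3 + m2"
      "k * x4\<^sup>2 + l * x4 + m = l2 * x4 + m2"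
    by (simp_all add: y l1_def m1_def l2_def m2_def power2_eq_square algebra_simps)
  have "point_add E (Affine x1 y1) (Affine x2 y2) = Affine x (l2 * x + m2)"
    unfolding y' point_add_if_line_meets[OF meets12]
    using secants_meet_in_opposite_points[OF meets k l1_def m1_def l2_def m2_def x_def] by simp
  then show ?thesis
    unfolding y' using point_add_if_line_meets[OF line_meets_permute(4)[OF meets34]] by simp
qed

lemma point_add_line:
  assumes "line_meets l m x1 x2 x3"
  shows "point_add E (point_add E (Affine x1 (l * x1 + m)) (Affine x2 (l * x2 + m)))
    (Affine x3 (l * x3 + m)) = Infinity"
  using point_add_if_line_meets[OF assms] point_add_opposite[of "neg_point (Affine x3 (l * x3 + m))"] by simp

lemma parabola_meets_if_line_meets:
  assumes meets: "line_meets l m x1 x2 x" and k: "k \<noteq> 0"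
    and x3: "k\<^sup>2 * (x3 - x1) * (x3 - x2) + k * (2 * (l * x3 + m) + a1 * x3 + a3) = x3 - x"
    and l': "l' = l - k * (x1 + x2)" and m': "m' = m + k * (x1 * x2)"
  shows "parabola_meets k l' m' x1 x2 x3 ((1 - 2 * k * l' - a1 * k) / k\<^sup>2 - (x1 + x2 + x3))"
proof -
  define x4 where "x4 = (1 - 2 * k * l' - a1 * k) / k\<^sup>2 - (x1 + x2 + x3)"
  define s p where "s = x1 + x2" and "p = x1 * x2"
  have line: "s + x = l\<^sup>2 + a1 * l - a2" "p + s * x = a4 - 2 * l * m - a1 * m - a3 * l"
      "p * x = m\<^sup>2 + a3 * m - a6"
    using meets unfolding line_meets_def s_def p_def by (simp_all add: algebra_simps)
  have sum: "k\<^sup>2 * (s + x3 + x4) = 1 - 2 * k * l' - a1 * k" using k by (simp add: x4_def s_def field_simps)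
  then have product: "k\<^sup>2 * (x3 * x4) = x + 2 * k * m + a3 * k + k\<^sup>2 * p"
    using x3 l' unfolding s_def p_def by Groebner_Basis.algebra
  have "l'\<^sup>2 + 2 * k * m' + a1 * l' + a3 * k - a2 = k\<^sup>2 * (p + s * (x3 + x4) + x3 * x4)"
    "2 * l' * m' + a1 * m' + a3 * l' - a4 = - k\<^sup>2 * (p * (x3 + x4) + s * (x3 * x4))"
    "m'\<^sup>2 + a3 * m' - a6 = k\<^sup>2 * (p * (x3 * x4))"
    using line l'[folded s_def] m'[folded p_def] sum product by Groebner_Basis.algebra+
  with sum show ?thesis
    unfolding parabola_meets_def x4_def[symmetric] s_def p_def by (simp add: algebra_simps)
qed

lemma line_or_parabola_through:
  assumes meets: "line_meets l m x1 x2 x" and on: "on_curve E (Affine x3 y3)" and ne: "x3 \<noteq> x1" "x3 \<noteq> x2"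
  obtains (line) "line_meets l m x1 x2 x3" "y3 = l * x3 + m"
  | (parabola) k l' m' x4 where "k \<noteq> 0" "parabola_meets k l' m' x1 x2 x3 x4"
      "l * x1 + m = k * x1\<^sup>2 + l' * x1 + m'" "l * x2 + m = k * x2\<^sup>2 + l' * x2 + m'"
      "y3 = k * x3\<^sup>2 + l' * x3 + m'"
proof -
  define d where "d = (x3 - x1) * (x3 - x2)"
  define k where "k = (y3 - (l * x3 + m)) / d"
  have d: "d \<noteq> 0" using ne by (simp add: d_def)
  have y3: "y3 = l * x3 + m + k * d" using d by (simp add: k_def)
  have "y3\<^sup>2 + a1 * x3 * y3 + a3 * y3 = x3 ^ 3 + a2 * x3\<^sup>2 + a4 * x3 + a6" using on by simp
  then have "d * (k\<^sup>2 * d + k * (2 * (l * x3 + m) + a1 * x3 + a3) - (x3 - x)) = 0"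
    using line_meets_factor[OF meets refl, of x3] y3 d_def by Groebner_Basis.algebra
  with d have x3: "k\<^sup>2 * d + k * (2 * (l * x3 + m) + a1 * x3 + a3) = x3 - x" by simp
  show ?thesis
  proof (cases "k = 0")
    case True
    then have "x = x3" using x3 by simp
    then show ?thesis using line meets y3 True by simp
  next
    case False
    have "k\<^sup>2 * (x3 - x1) * (x3 - x2) + k * (2 * (l * x3 + m) + a1 * x3 + a3) = x3 - x"
      using x3 by (simp add: d_def mult.assoc)
    from parabola[OF False parabola_meets_if_line_meets[OF meets False this refl refl]] show ?thesis
      using y3 by (simp add: d_def power2_eq_square algebra_simps)
  qed
qed

lemma point_add_rotate:
  assumes on: "on_curve E (Affine x1 y1)" "on_curve E (Affine x2 y2)" "on_curve E (Affine x3 y3)"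
    and ne: "Affine x2 y2 \<noteq> neg_point (Affine x1 y1)" "x3 \<noteq> x1" "x3 \<noteq> x2"
  shows "point_add E (point_add E (Affine x1 y1) (Affine x2 y2)) (Affine x3 y3) =
    point_add E (point_add E (Affine x2 y2) (Affine x3 y3)) (Affine x1 y1)"
proof -
  obtain l m x where meets: "line_meets l m x1 x2 x" and y: "y1 = l * x1 + m" "y2 = l * x2 + m"
    using on(1,2) ne(1) by (cases rule: point_add_cases) auto
  from meets on(3) ne(2,3) show ?thesis
  proof (cases rule: line_or_parabola_through)
    case line
    then show ?thesis
      using point_add_line[OF line(1)] point_add_line[OF line_meets_permute(3)[OF line(1)]] y by simp
  next
    case (parabola k l' m' x4)
    note y' = y(1)[unfolded parabola(3)] y(2)[unfolded parabola(4)] parabola(5)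
    show ?thesis
      using point_add_parabola[OF parabola(2,1) y']
        point_add_parabola[OF parabola_meets_permute(1)[OF parabola(2)] parabola(1) y'(2,3,1)] by simp
  qed
qed

theorem point_add_assoc:
  assumes P: "on_curve E P" and Q: "on_curve E Q" and R: "on_curve E R"
  shows "point_add E (point_add E P Q) R = point_add E P (point_add E Q R)"
proof -
  note comm = point_add_commute and on = on_curve_point_add and cancel = point_add_neg_cancel
  consider (Infinity) "P = Infinity \<or> Q = Infinity \<or> R = Infinity"
    | (PQ) "Q = neg_point P" | (QR) "R = neg_point Q" | (PR) "R = neg_point P" | (eq) "P = R"
    | (generic) x1 y1 x2 y2 x3 y3 where "P = Affine x1 y1" "Q = Affine x2 y2" "R = Affine x3 y3"
        "Q \<noteq> neg_point P" "R \<noteq> neg_point Q" "R \<noteq> neg_point P" "P \<noteq> R"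
    by (metis point.exhaust)
  then show ?thesis
  proof cases
    case Infinity
    then show ?thesis by auto
  next
    case PQ
    then show ?thesis using cancel[OF Q R] point_add_opposite[of P] by simp
  next
    case QR
    then show ?thesis using cancel[OF Q P] comm[OF P Q] comm[OF R on[OF Q P]] point_add_opposite[of Q] by simp
  next
    case PR
    then show ?thesis using cancel[OF P Q] cancel[OF R Q] comm[OF on[OF P Q] R] comm[OF Q R] by simp
  next
    case eq
    then show ?thesis using comm P Q on by metis
  next
    case generic
    have x13: "x1 \<noteq> x3" using y_eq_or_opposite P R generic by blast
    show ?thesis
    proof (cases "x2 = x3")
      case False
      then show ?thesis
        using point_add_rotate[of x1 y1 x2 y2 x3 y3] P Q R generic x13 comm[OF on[OF Q R] P] by simp
    next
      case True
      then have "Q = R" using y_eq_or_opposite Q R generic by blast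
      then show ?thesis
        using point_add_rotate[of x3 y3 x3 y3 x1 y1] P R generic x13 True
          comm[OF on[OF P R] R] comm[OF P R] comm[OF on[OF R R] P] by simp
    qed
  qed
qed

end

section \<open>Free subgroups of abelian groups\<close>

lemma (in group) has_subgroup_isomorphic_toI:
  assumes A: "group A" and f: "f \<in> hom A G" "inj_on f (carrier A)"
  shows "has_subgroup_isomorphic_to G A"
proof -
  interpret f: group_hom A G f
    using A f(1) is_group by (simp add: group_hom_def group_hom_axioms_def)
  have "f \<in> iso A (G\<lparr>carrier := f ` carrier A\<rparr>)"
    using f by (auto simp: iso_def hom_def bij_betw_def)
  then have "G\<lparr>carrier := f ` carrier A\<rparr> \<cong> A"
    using group.iso_sym[OF A] by (auto simp: is_iso_def)
  then show ?thesis
    unfolding has_subgroup_isomorphic_to_def using f.img_is_subgroup by blast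
qed

lemma has_subgroup_isomorphic_to_iso:
  assumes "has_subgroup_isomorphic_to M G" "G \<cong> H"
  shows "has_subgroup_isomorphic_to M H"
  using assms iso_trans unfolding has_subgroup_isomorphic_to_def by blast

lemma DirProd_assoc_iso: "(G \<times>\<times> H) \<times>\<times> I \<cong> G \<times>\<times> (H \<times>\<times> I)"
proof -
  have "(\<lambda>((x, y), z). (x, y, z)) \<in> iso ((G \<times>\<times> H) \<times>\<times> I) (G \<times>\<times> (H \<times>\<times> I))"
    by (auto simp: iso_def hom_def bij_betw_def inj_on_def image_iff)
  then show ?thesis by (auto simp: is_iso_def)
qed

lemma free_abelian_group_of_rank_1_iso: "free_abelian_group_of_rank 1 \<cong> integer_group"
proof -
  have "bij_betw (\<lambda>f. f 0) (carrier (free_abelian_group_of_rank 1)) (carrier integer_group)"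
    by (rule bij_betw_byWitness[where f' = "\<lambda>y. \<lambda>i\<in>{..<1}. y"])
      (auto simp: PiE_def extensional_def lessThan_Suc restrict_def)
  moreover have "(\<lambda>f. f 0) \<in> hom (free_abelian_group_of_rank 1) integer_group"
    by (rule homI) auto
  ultimately have "(\<lambda>f. f 0) \<in> iso (free_abelian_group_of_rank 1) integer_group" by (simp add: iso_def)
  then show ?thesis by (auto simp: is_iso_def)
qed

lemma int_eq_0_if_powers_dvd:
  fixes x :: int
  assumes "\<And>n. 2 ^ n dvd x"
  shows "x = 0"
proof -
  have "2 ^ nat \<bar>x\<bar> dvd \<bar>x\<bar>" using assms by simp
  moreover have "\<bar>x\<bar> < 2 ^ nat \<bar>x\<bar>"
    using of_nat_less_iff[where 'a = int, THEN iffD2, OF less_exp[of "nat \<bar>x\<bar>"]] by simp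
  ultimately show ?thesis using zdvd_not_zless[of "\<bar>x\<bar>"] by fastforce
qed

context group
begin

lemma int_pow_hom_integer_mod_group:
  assumes t: "t \<in> carrier G" and k: "ord t dvd k" "k > 0"
  shows "(\<lambda>x::int. t [^] x) \<in> hom (integer_mod_group k) G"
proof (rule homI)
  fix x y :: int
  have "t [^] ((x + y) mod int k) = t [^] (x + y)"
    using k(1) by (simp add: int_pow_eq[OF t] mod_eq_dvd_iff[symmetric] mod_mod_cancel)
  then show "t [^] (x \<otimes>\<^bsub>integer_mod_group k\<^esub> y) = t [^] x \<otimes> t [^] y"
    using t by (simp add: int_pow_mult)
qed (use t in simp)

lemma int_pow_inj_on_integer_mod_group:
  assumes "t \<in> carrier G" "ord t = k" "k > 0"
  shows "inj_on (\<lambda>x::int. t [^] x) (carrier (integer_mod_group k))"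
proof (rule inj_onI)
  fix x y :: int
  assume "x \<in> carrier (integer_mod_group k)" "y \<in> carrier (integer_mod_group k)" "t [^] x = t [^] y"
  then have "x mod int k = x" "y mod int k = y" "int k dvd y - x"
    using assms int_pow_eq[of t x y] by (auto simp: carrier_integer_mod_group)
  then show "x = y" by (metis mod_eq_dvd_iff)
qed

lemma ord_eqI:
  assumes t: "t \<in> carrier G" "t [^] n = \<one>" and n: "n > 0"
    and prime: "\<And>q. q \<in> prime_factors n \<Longrightarrow> t [^] (n div q) \<noteq> \<one>"
  shows "ord t = n"
proof -
  obtain m where m: "n = ord t * m" using t pow_eq_id by (auto elim: dvdE)
  have "m = 1"
  proof (rule ccontr)
    assume "m \<noteq> 1"
    then obtain q j where q: "prime q" "m = q * j" using prime_factor_nat[of m] by (auto elim: dvdE)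
    then have "n div q = ord t * j" "q \<in> prime_factors n"
      using m n by (auto simp: prime_gt_0_nat prime_factors_dvd)
    then show False using prime[of q] t pow_eq_id by simp
  qed
  with m show ?thesis by simp
qed

lemma nat_pow_add_eq:
  assumes "t \<in> carrier G" "t [^] m = u" "t [^] n = v" "u \<otimes> v = w" "k = m + (n::nat)"
  shows "t [^] k = w"
  using assms by (simp flip: nat_pow_mult)

lemma ord_eq_2I:
  assumes x: "x \<in> carrier G" "x \<otimes> x = \<one>" "x \<noteq> \<one>"
  shows "ord x = 2"
proof -
  have "x [^] (2::nat) = \<one>" using x by (simp add: numeral_2_eq_2)
  then have "ord x dvd 2" using pow_eq_id x(1) by blast
  moreover have "ord x \<noteq> 1" using ord_eq_1 x by blast
  ultimately show ?thesis using two_is_prime_nat by (auto simp: prime_nat_iff)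
qed

end

context comm_group
begin

definition squares :: "'a set" where
  "squares = {x \<otimes> x |x. x \<in> carrier G}"

lemma subgroup_squares: "subgroup squares G"
proof (rule subgroupI)
  show "squares \<subseteq> carrier G" "squares \<noteq> {}" by (auto simp: squares_def)
next
  fix x assume "x \<in> squares"
  then obtain y where "y \<in> carrier G" "x = y \<otimes> y" by (auto simp: squares_def)
  then have "inv x = inv y \<otimes> inv y" "inv y \<in> carrier G" by (simp_all add: inv_mult)
  then show "inv x \<in> squares" by (auto simp: squares_def)
next
  fix x y assume "x \<in> squares" "y \<in> squares"
  then obtain u v where uv: "u \<in> carrier G" "v \<in> carrier G" "x = u \<otimes> u" "y = v \<otimes> v" by (auto simp: squares_def)
  then have "x \<otimes> y = (u \<otimes> v) \<otimes> (u \<otimes> v)" by (simp add: m_ac)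
  then show "x \<otimes> y \<in> squares" using uv by (auto simp: squares_def)
qed

lemma even_int_pow_in_squares:
  assumes "x \<in> carrier G" "even n"
  shows "x [^] (n::int) \<in> squares"
proof -
  obtain k where "n = k + k" using assms(2) by (metis evenE mult_2)
  then have "x [^] n = x [^] k \<otimes> x [^] k" using int_pow_mult[OF assms(1), of k k] by simp
  then show ?thesis using assms(1) by (auto simp: squares_def)
qed

lemma even_if_int_pow_in_subgroup:
  assumes N: "subgroup N G" "squares \<subseteq> N" and x: "x \<in> carrier G" "x \<notin> N" and pow: "x [^] (n::int) \<in> N"
  shows "even n"
proof (rule ccontr)
  assume "odd n"
  then have "x [^] (1 - n) \<in> N" using even_int_pow_in_squares[of x "1 - n"] x(1) N(2) by auto
  then have "x [^] n \<otimes> x [^] (1 - n) \<in> N" using pow N(1) by (simp add: subgroup.m_closed)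
  then show False using x by (simp flip: int_pow_mult)
qed

definition combination :: "'a list \<Rightarrow> (nat \<Rightarrow> int) \<Rightarrow> 'a" where
  "combination gs n = (\<Otimes>i\<in>{..<length gs}. gs ! i [^] n i)"

lemma combination_Nil [simp]: "combination [] n = \<one>"
  by (simp add: combination_def)

lemma combination_closed [simp]:
  assumes "set gs \<subseteq> carrier G"
  shows "combination gs n \<in> carrier G"
  unfolding combination_def using assms by (intro finprod_closed) (auto dest: nth_mem)

lemma combination_cong:
  assumes "set gs \<subseteq> carrier G" "\<And>i. i < length gs \<Longrightarrow> n i = k i"
  shows "combination gs n = combination gs k"
  unfolding combination_def using assms by (intro finprod_cong') (auto dest: nth_mem)

lemma combination_add:
  assumes "set gs \<subseteq> carrier G"
  shows "combination gs (\<lambda>i. n i + k i) = combination gs n \<otimes> combination gs k"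
proof -
  have g: "gs ! i \<in> carrier G" if "i < length gs" for i using assms that by (auto dest: nth_mem)
  then have "combination gs (\<lambda>i. n i + k i) = (\<Otimes>i\<in>{..<length gs}. gs ! i [^] n i \<otimes> gs ! i [^] k i)"
    unfolding combination_def by (intro finprod_cong') (auto simp: int_pow_mult)
  also have "\<dots> = combination gs n \<otimes> combination gs k"
    unfolding combination_def using g by (intro finprod_multf) auto
  finally show ?thesis .
qed

lemma combination_eq_one:
  assumes "\<And>i. i < length gs \<Longrightarrow> n i = 0"
  shows "combination gs n = \<one>"
  unfolding combination_def using assms by (intro finprod_one_eqI) auto

lemma combination_nat_pow:
  assumes "set gs \<subseteq> carrier G"
  shows "combination gs n [^] (k::nat) = combination gs (\<lambda>i. int k * n i)"
proof (induction k)
  case (Suc k)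
  then show ?case using combination_add[OF assms, of "\<lambda>i. int k * n i" n] assms
    by (simp add: distrib_right add.commute)
qed (simp add: combination_eq_one)

lemma combination_snoc:
  assumes "set gs \<subseteq> carrier G" "g \<in> carrier G"
  shows "combination (gs @ [g]) n = combination gs n \<otimes> g [^] n (length gs)"
proof -
  have gs: "gs ! i \<in> carrier G" if "i < length gs" for i using assms(1) that by (auto dest: nth_mem)
  have "combination (gs @ [g]) n =
      g [^] n (length gs) \<otimes> (\<Otimes>i\<in>{..<length gs}. (gs @ [g]) ! i [^] n i)"
    unfolding combination_def using assms(2) gs by (simp add: lessThan_Suc nth_append Pi_def)
  also have "(\<Otimes>i\<in>{..<length gs}. (gs @ [g]) ! i [^] n i) = combination gs n"
    unfolding combination_def using gs by (intro finprod_cong') (auto simp: nth_append)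
  finally show ?thesis using assms by (simp add: m_comm)
qed

lemma combination_append:
  assumes "set gs \<subseteq> carrier G" "set hs \<subseteq> carrier G"
  shows "combination (gs @ hs) n = combination gs n \<otimes> combination hs (\<lambda>i. n (length gs + i))"
  using assms(2)
proof (induction hs rule: rev_induct)
  case (snoc h hs)
  then show ?case
    using assms(1) combination_snoc[of "gs @ hs" h n] combination_snoc[of hs h "\<lambda>i. n (length gs + i)"]
    by (simp add: m_assoc)
qed (use assms(1) in simp)

lemma combination_remove:
  assumes gs: "set gs \<subseteq> carrier G" and k: "k < length gs"
  shows "combination gs n = gs ! k [^] n k \<otimes> combination gs (n(k := 0))"
proof -
  have g: "gs ! i \<in> carrier G" if "i < length gs" for i using gs that by (auto dest: nth_mem)
  have "combination gs n = combination gs (\<lambda>i. (if k = i then n i else 0) + (n(k := 0)) i)"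
    using gs by (intro combination_cong) auto
  also have "\<dots> = combination gs (\<lambda>i. if k = i then n i else 0) \<otimes> combination gs (n(k := 0))"
    using gs by (rule combination_add)
  also have "combination gs (\<lambda>i. if k = i then n i else 0) =
      (\<Otimes>i\<in>{..<length gs}. if k = i then gs ! i [^] n i else \<one>)"
    unfolding combination_def using g by (intro finprod_cong') auto
  also have "\<dots> = gs ! k [^] n k" using g k by (intro finprod_singleton) auto
  finally show ?thesis .
qed

lemma combination_in_subgroup:
  assumes N: "subgroup N G" and gs: "set gs \<subseteq> carrier G"
    and mem: "\<And>i. i < length gs \<Longrightarrow> gs ! i [^] n i \<in> N"
  shows "combination gs n \<in> N"
  using gs mem
proof (induction gs rule: rev_induct)
  case Nil
  then show ?case using N by (simp add: subgroup.one_closed)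
next
  case (snoc g gs)
  have "gs ! i [^] n i \<in> N" if "i < length gs" for i using snoc.prems(2)[of i] that by (simp add: nth_append)
  then have "combination gs n \<in> N" using snoc.IH snoc.prems(1) by simp
  moreover have "g [^] n (length gs) \<in> N" using snoc.prems(2)[of "length gs"] by simp
  ultimately show ?case using snoc.prems N by (simp add: combination_snoc subgroup.m_closed)
qed

lemma combination_hom:
  assumes "set gs \<subseteq> carrier G"
  shows "combination gs \<in> hom (free_abelian_group_of_rank (length gs)) G"
proof (rule homI)
  fix x y :: "nat \<Rightarrow> int"
  have "combination gs (x \<otimes>\<^bsub>free_abelian_group_of_rank (length gs)\<^esub> y) = combination gs (\<lambda>i. x i + y i)"
    using assms by (intro combination_cong) auto
  then show "combination gs (x \<otimes>\<^bsub>free_abelian_group_of_rank (length gs)\<^esub> y) =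
      combination gs x \<otimes> combination gs y"
    using combination_add[OF assms] by simp
qed (use assms in simp)

definition independent_mod_squares :: "'a list \<Rightarrow> bool" where
  "independent_mod_squares gs \<longleftrightarrow>
     (\<forall>n. combination gs n \<in> squares \<longrightarrow> (\<forall>i<length gs. even (n i)))"

lemma even_if_combination_in_subgroup:
  assumes N: "subgroup N G" "squares \<subseteq> N" and gs: "set gs \<subseteq> carrier G" and k: "k < length gs" "gs ! k \<notin> N"
    and others: "\<And>i. i < length gs \<Longrightarrow> i \<noteq> k \<Longrightarrow> gs ! i \<in> N \<or> even (n i)"
    and comb: "combination gs n \<in> N"
  shows "even (n k)"
proof -
  have g: "gs ! i \<in> carrier G" if "i < length gs" for i using gs that by (auto dest: nth_mem)
  have "combination gs (n(k := 0)) \<in> N"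
    using N(1) gs
  proof (rule combination_in_subgroup)
    fix i assume i: "i < length gs"
    show "gs ! i [^] (n(k := 0)) i \<in> N"
      using others[OF i] i g N(2) even_int_pow_in_squares
        subgroup_int_pow_closed[OF N(1)] subgroup.one_closed[OF N(1)] by fastforce
  qed
  moreover have "gs ! k [^] n k = combination gs n \<otimes> inv (combination gs (n(k := 0)))"
    unfolding combination_remove[OF gs k(1), of n] using g k gs by (simp add: m_assoc)
  ultimately have "gs ! k [^] n k \<in> N"
    using comb N(1) by (simp add: subgroup.m_closed subgroup.m_inv_closed)
  then show ?thesis using even_if_int_pow_in_subgroup[OF N] g k by blast
qed

lemma independent_mod_squares_if_separated:
  assumes gs: "set gs \<subseteq> carrier G"
    and separated: "\<And>k. k < length gs \<Longrightarrow>
      \<exists>N. subgroup N G \<and> squares \<subseteq> N \<and> gs ! k \<notin> N \<and> (\<forall>i<length gs. k < i \<longrightarrow> gs ! i \<in> N)"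
  shows "independent_mod_squares gs"
  unfolding independent_mod_squares_def
proof (intro allI impI)
  fix n k assume "combination gs n \<in> squares" and "k < length gs"
  then show "even (n k)"
  proof (induction k rule: less_induct)
    case (less k)
    obtain N where N: "subgroup N G" "squares \<subseteq> N" "gs ! k \<notin> N" "\<forall>i<length gs. k < i \<longrightarrow> gs ! i \<in> N"
      using separated[OF less.prems(2)] by blast
    have "gs ! i \<in> N \<or> even (n i)" if "i < length gs" "i \<noteq> k" for i
      using that N(4) less by (metis linorder_neqE_nat)
    then show ?case
      using even_if_combination_in_subgroup[OF N(1,2) gs less.prems(2) N(3)] less.prems(1) N(2) by blast
  qed
qed

lemma hom_DirProd_mult:
  assumes f: "f \<in> hom A G" and g: "g \<in> hom B G"
  shows "(\<lambda>(x, y). f x \<otimes> g y) \<in> hom (A \<times>\<times> B) G"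
proof -
  have "f x \<in> carrier G" "g y \<in> carrier G" if "x \<in> carrier A" "y \<in> carrier B" for x y
    using f g that by (auto simp: hom_def)
  then show ?thesis using f g by (auto simp: hom_def m_ac)
qed

context
  fixes ts gs
  assumes ts: "set ts \<subseteq> carrier G" and gs: "set gs \<subseteq> carrier G"
    and independent: "independent_mod_squares (ts @ gs)"
    and two_torsion: "\<And>x. x \<in> carrier G \<Longrightarrow> x \<otimes> x = \<one> \<Longrightarrow> \<exists>c. x = combination ts c"
begin

text \<open>Infinite descent: a relation has even exponents, and half of it is a relation up to \<open>2\<close>-torsion.\<close>

lemma relation_trivial_outside_two_torsion:
  assumes rel: "combination (ts @ gs) n = \<one>" and i: "i < length gs"
  shows "n (length ts + i) = 0"
proof -
  have all: "set (ts @ gs) \<subseteq> carrier G" using ts gs by simp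
  have "2 ^ N dvd n (length ts + i)" for N
    using rel
  proof (induction N arbitrary: n)
    case (Suc N)
    define k where "k j = n j div 2" for j
    have "\<one> \<in> squares" using subgroup.one_closed[OF subgroup_squares] .
    then have n: "n j = k j + k j" if "j < length (ts @ gs)" for j
      using independent Suc.prems that unfolding independent_mod_squares_def k_def by fastforce
    have "combination (ts @ gs) k \<otimes> combination (ts @ gs) k = \<one>"
      using Suc.prems combination_add[OF all, of k k] combination_cong[OF all n] by simp
    then obtain c where c: "combination (ts @ gs) k = combination ts c"
      using two_torsion[of "combination (ts @ gs) k"] all by auto
    define c' where "c' j = (if j < length ts then c j else 0)" for j
    have "combination (ts @ gs) c' = combination ts c"
      using combination_append[OF ts gs, of c'] combination_cong[OF ts, of c' c] ts
      by (simp add: c'_def combination_eq_one)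
    moreover have "combination (ts @ gs) k = combination (ts @ gs) (\<lambda>j. k j - c' j) \<otimes> combination (ts @ gs) c'"
      using combination_add[OF all, of "\<lambda>j. k j - c' j" c'] by simp
    ultimately have "combination (ts @ gs) (\<lambda>j. k j - c' j) = \<one>"
      using c all by (metis combination_closed r_cancel_one')
    from Suc.IH[OF this] have "2 ^ N dvd k (length ts + i)" by (simp add: c'_def)
    then show ?case using n[of "length ts + i"] i by (auto simp: dvd_def)
  qed simp
  then show ?thesis by (rule int_eq_0_if_powers_dvd)
qed

lemma combination_eq_one_imp_zero:
  assumes rel: "combination gs n = \<one>" and i: "i < length gs"
  shows "n i = 0"
proof -
  define n' where "n' j = (if j < length ts then 0 else n (j - length ts))" for j
  have "combination (ts @ gs) n' = \<one>"
    using combination_append[OF ts gs] rel by (simp add: n'_def combination_eq_one)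
  from relation_trivial_outside_two_torsion[OF this i] show ?thesis
    by (simp add: n'_def)
qed

lemma has_subgroup_isomorphic_to_finite_times_free:
  assumes T: "group T" "finite (carrier T)" and f: "f \<in> hom T G" "inj_on f (carrier T)"
  shows "has_subgroup_isomorphic_to G (T \<times>\<times> free_abelian_group_of_rank (length gs))"
proof (rule has_subgroup_isomorphic_toI)
  let ?F = "free_abelian_group_of_rank (length gs)" and ?h = "\<lambda>(x, y). f x \<otimes> combination gs y"
  show grp: "group (T \<times>\<times> ?F)" using T by (simp add: DirProd_group)
  show hom: "?h \<in> hom (T \<times>\<times> ?F) G" using f(1) combination_hom[OF gs] by (rule hom_DirProd_mult)
  interpret f: group_hom T G f
    using T(1) f(1) is_group by (simp add: group_hom_def group_hom_axioms_def)
  interpret h: group_hom "T \<times>\<times> ?F" G ?h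
    using grp hom is_group by (simp add: group_hom_def group_hom_axioms_def)
  have "x = \<one>\<^bsub>T\<^esub> \<and> y = \<one>\<^bsub>?F\<^esub>"
    if x: "x \<in> carrier T" and y: "y \<in> carrier ?F" and rel: "f x \<otimes> combination gs y = \<one>" for x y
  proof -
    define m where "m = group.ord T x"
    have m: "m > 0" using group.ord_ge_1[OF T x] by (simp add: m_def)
    have "f x [^] m \<otimes> combination gs y [^] m = (f x \<otimes> combination gs y) [^] m"
      using gs x by (simp add: pow_mult_distrib m_comm)
    moreover have "f x [^] m = \<one>"
      using group.pow_ord_eq_1[OF T(1) x] x by (simp add: m_def flip: f.hom_nat_pow)
    ultimately have "combination gs (\<lambda>i. int m * y i) = \<one>"
      using rel gs by (simp add: combination_nat_pow)
    then have y0: "y i = 0" if "i < length gs" for i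
      using combination_eq_one_imp_zero that m by fastforce
    then have "f x = \<one>" using rel x by (simp add: combination_eq_one)
    moreover have "y = \<one>\<^bsub>?F\<^esub>" using y y0 by (auto simp: PiE_iff extensional_def fun_eq_iff)
    ultimately show ?thesis using x f(2) f.inj_on_one_iff by blast
  qed
  then show "inj_on ?h (carrier (T \<times>\<times> ?F))" unfolding h.inj_on_one_iff by fastforce
qed

theorem has_subgroup_isomorphic_to_cyclic_times_free:
  assumes t: "t \<in> carrier G" "ord t = k" "k > 0"
  shows "has_subgroup_isomorphic_to G (integer_mod_group k \<times>\<times> free_abelian_group_of_rank (length gs))"
  using t int_pow_hom_integer_mod_group[of t k] int_pow_inj_on_integer_mod_group[of t k]
  by (intro has_subgroup_isomorphic_to_finite_times_free)
    (auto simp: carrier_integer_mod_group)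

end

lemma int_pow_mult_inj_on_DirProd:
  assumes s: "s \<in> carrier G" "ord s = 2" and t: "t \<in> carrier G" "ord t = 2 * m" "m > 0" and st: "s \<noteq> t [^] m"
  shows "inj_on (\<lambda>(x::int, y::int). s [^] x \<otimes> t [^] y)
    (carrier (integer_mod_group 2 \<times>\<times> integer_mod_group (2 * m)))"
proof -
  let ?A = "integer_mod_group 2 \<times>\<times> integer_mod_group (2 * m)" and ?f = "\<lambda>(x::int, y::int). s [^] x \<otimes> t [^] y"
  have "?f \<in> hom ?A G"
    using s t by (intro hom_DirProd_mult int_pow_hom_integer_mod_group) auto
  then interpret f: group_hom ?A G ?f
    using is_group by (simp add: group_hom_def group_hom_axioms_def DirProd_group)
  have "x = 0 \<and> y = 0" if x: "x \<in> {0..<2}" and y: "y \<in> {0..<2 * int m}" and rel: "s [^] x \<otimes> t [^] y = \<one>"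
    for x y :: int
  proof -
    have "x = 0 \<or> x = 1" using x by auto
    then show ?thesis
    proof
      assume "x = 0"
      then have "2 * int m dvd y" using rel t int_pow_eq_id[of t y] by simp
      then show ?thesis using \<open>x = 0\<close> y zdvd_not_zless[of y "2 * int m"] by fastforce
    next
      assume "x = 1"
      then have "s \<otimes> t [^] y = s \<otimes> s" using rel s pow_eq_id[of s 2] by (simp add: numeral_2_eq_2)
      then have ty: "t [^] y = s" using s t by simp
      then have "t [^] (y * 2) = \<one>" using s t int_pow_eq_id[of s 2] by (simp flip: int_pow_pow)
      then obtain j where j: "y = int m * j" using t int_pow_eq_id[of t "y * 2"] by (auto elim: dvdE)
      then have "j = 0 \<or> j = 1"
        using y t(3) mult_less_cancel_left_pos[of "int m" j 2] by (auto simp: zero_le_mult_iff)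
      then show ?thesis using ty j st s ord_eq_1[of s] by (auto simp: int_pow_int)
    qed
  qed
  then show ?thesis unfolding f.inj_on_one_iff using t by (auto simp: carrier_integer_mod_group)
qed

theorem has_subgroup_isomorphic_to_two_cyclic_times_free:
  assumes s: "s \<in> carrier G" "ord s = 2" and t: "t \<in> carrier G" "ord t = 2 * m" "m > 0" and st: "s \<noteq> t [^] m"
    and gs: "set gs \<subseteq> carrier G" and independent: "independent_mod_squares ([s, t] @ gs)"
    and two_torsion: "\<And>x. x \<in> carrier G \<Longrightarrow> x \<otimes> x = \<one> \<Longrightarrow> x \<in> {\<one>, s, t [^] m, s \<otimes> t [^] m}"
  shows "has_subgroup_isomorphic_to G
    (integer_mod_group 2 \<times>\<times> integer_mod_group (2 * m) \<times>\<times> free_abelian_group_of_rank (length gs))"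
proof -
  let ?T = "integer_mod_group 2 \<times>\<times> integer_mod_group (2 * m)"
  have comb: "s [^] x \<otimes> t [^] y = combination [s, t] (\<lambda>i. if i = 0 then x else y)" for x y
    using combination_snoc[of "[s]" t] combination_snoc[of "[]" s] s t by simp
  have "has_subgroup_isomorphic_to G (?T \<times>\<times> free_abelian_group_of_rank (length gs))"
  proof (rule has_subgroup_isomorphic_to_finite_times_free
      [OF _ gs independent _ _ _ _ int_pow_mult_inj_on_DirProd[OF s t st]])
    show "(\<lambda>(x, y). s [^] x \<otimes> t [^] y) \<in> hom ?T G"
      using s t by (intro hom_DirProd_mult int_pow_hom_integer_mod_group) auto
    fix x assume x: "x \<in> carrier G" "x \<otimes> x = \<one>"
    have "\<one> = s [^] (0::int) \<otimes> t [^] (0::int)" "s = s [^] (1::int) \<otimes> t [^] (0::int)"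
      "t [^] m = s [^] (0::int) \<otimes> t [^] int m" "s \<otimes> t [^] m = s [^] (1::int) \<otimes> t [^] int m"
      using s t by (simp_all add: int_pow_int)
    then show "\<exists>c. x = combination [s, t] c"
      using two_torsion[OF x] unfolding comb by blast
  qed (use s t in \<open>auto simp: carrier_integer_mod_group DirProd_group\<close>)
  then show ?thesis using has_subgroup_isomorphic_to_iso DirProd_assoc_iso by blast
qed

end

section \<open>Mordell--Weil groups over subfields\<close>

locale subfield_of_type =
  fixes K :: "'a::field set"
  assumes one_closed: "1 \<in> K"
    and diff_closed: "x \<in> K \<Longrightarrow> y \<in> K \<Longrightarrow> x - y \<in> K"
    and mult_closed: "x \<in> K \<Longrightarrow> y \<in> K \<Longrightarrow> x * y \<in> K"
    and inverse_closed: "x \<in> K \<Longrightarrow> inverse x \<in> K"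
begin

lemma zero_closed: "0 \<in> K"
  using diff_closed[OF one_closed one_closed] by simp

lemma uminus_closed: "x \<in> K \<Longrightarrow> - x \<in> K"
  using diff_closed[OF zero_closed] by fastforce

lemma add_closed: "x \<in> K \<Longrightarrow> y \<in> K \<Longrightarrow> x + y \<in> K"
  using diff_closed[of x "- y"] uminus_closed by simp

lemma divide_closed: "x \<in> K \<Longrightarrow> y \<in> K \<Longrightarrow> x / y \<in> K"
  by (simp add: divide_inverse mult_closed inverse_closed)

lemma of_nat_closed: "of_nat n \<in> K"
  by (induction n) (auto intro: zero_closed one_closed add_closed)

lemma of_int_closed: "of_int k \<in> K"
  by (cases k) (auto intro: of_nat_closed uminus_closed simp del: of_nat_Suc)

lemma numeral_closed: "numeral k \<in> K"
  using of_nat_closed[of "numeral k"] by simp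

lemma power_closed: "x \<in> K \<Longrightarrow> x ^ n \<in> K"
  by (induction n) (auto intro: one_closed mult_closed)

lemmas field_closed = one_closed zero_closed uminus_closed add_closed diff_closed mult_closed
  inverse_closed divide_closed of_int_closed numeral_closed power_closed

lemma subfield_ring_of_type_algebra: "subfield K ring_of_type_algebra"
proof -
  let ?R = "ring_of_type_algebra :: 'a ring"
  interpret R: field ?R by (rule field_from_type_algebra)
  show ?thesis
  proof (rule R.subfieldI')
    have "\<ominus>\<^bsub>?R\<^esub> x = - x" for x
      by (rule R.minus_equality) (auto simp: ring_of_type_algebra_def)
    then show "subring K ?R"
      by (intro R.subringI) (auto simp: ring_of_type_algebra_def intro: field_closed)
    fix x assume x: "x \<in> K - {\<zero>\<^bsub>?R\<^esub>}"
    then have "inv\<^bsub>?R\<^esub> x = inverse x"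
      by (intro R.comm_inv_char) (auto simp: ring_of_type_algebra_def)
    then show "inv\<^bsub>?R\<^esub> x \<in> K" using x inverse_closed by simp
  qed
qed

end

locale elliptic_curve_subfield = elliptic_curve a1 a2 a3 a4 a6 + subfield_of_type K
  for a1 a2 a3 a4 a6 :: "'a::field" and K +
  assumes coefficients: "a1 \<in> K" "a2 \<in> K" "a3 \<in> K" "a4 \<in> K" "a6 \<in> K"
begin

abbreviation "MW \<equiv> mordell_weil_group E K"

lemma elliptic_curve_over: "elliptic_curve_over K E"
  using coefficients discriminant_nonzero by (simp add: elliptic_curve_over_def)

lemma carrier_MW: "carrier MW = {P. on_curve E P \<and> set_point P \<subseteq> K}"
  and mult_MW: "P \<otimes>\<^bsub>MW\<^esub> Q = point_add E P Q"
  and one_MW: "\<one>\<^bsub>MW\<^esub> = Infinity"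
  by (simp_all add: mordell_weil_group_def)

lemma slope_closed:
  assumes "x1 \<in> K" "y1 \<in> K" "x2 \<in> K" "y2 \<in> K"
  shows "slope x1 y1 x2 y2 \<in> K"
  using assms coefficients unfolding slope_def by (auto intro!: field_closed)

lemma neg_point_MW: "P \<in> carrier MW \<Longrightarrow> neg_point P \<in> carrier MW"
  using on_curve_neg_point[of P] coefficients by (cases P) (auto simp: carrier_MW intro!: field_closed)

lemma point_add_MW:
  assumes "P \<in> carrier MW" "Q \<in> carrier MW"
  shows "point_add E P Q \<in> carrier MW"
proof -
  have "set_point (point_add E P Q) \<subseteq> K"
  proof (cases P; cases Q)
    fix x1 y1 x2 y2 assume PQ: "P = Affine x1 y1" "Q = Affine x2 y2"
    show ?thesis
    proof (cases "x1 = x2 \<and> y1 + y2 + a1 * x2 + a3 = 0")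
      case True
      then show ?thesis using PQ by (simp add: point_add.simps(3))
    next
      case False
      have inK: "x1 \<in> K" "y1 \<in> K" "x2 \<in> K" "y2 \<in> K" using assms PQ by (auto simp: carrier_MW)
      show ?thesis
        unfolding PQ point_add_slope[OF False refl refl] using inK coefficients
        by (auto intro!: field_closed slope_closed)
    qed
  qed (use assms in \<open>auto simp: carrier_MW\<close>)
  then show ?thesis using assms on_curve_point_add by (auto simp: carrier_MW)
qed

theorem comm_group_MW: "comm_group MW"
proof (rule comm_groupI)
  fix P assume P: "P \<in> carrier MW"
  then have "point_add E (neg_point P) P = Infinity"
    using point_add_opposite[of "neg_point P"] by simp
  then show "\<exists>Q\<in>carrier MW. Q \<otimes>\<^bsub>MW\<^esub> P = \<one>\<^bsub>MW\<^esub>"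
    using neg_point_MW[OF P] by (auto simp: mult_MW one_MW)
next
  fix P Q assume "P \<in> carrier MW" "Q \<in> carrier MW"
  then show "P \<otimes>\<^bsub>MW\<^esub> Q \<in> carrier MW" "P \<otimes>\<^bsub>MW\<^esub> Q = Q \<otimes>\<^bsub>MW\<^esub> P"
    using point_add_MW point_add_commute by (simp_all add: carrier_MW mult_MW)
qed (auto simp: point_add_assoc carrier_MW mult_MW one_MW)

sublocale MW: comm_group MW
  by (rule comm_group_MW)

lemma inv_MW: "P \<in> carrier MW \<Longrightarrow> inv\<^bsub>MW\<^esub> P = neg_point P"
  using neg_point_MW point_add_opposite[of "neg_point P"]
  by (intro MW.inv_equality) (auto simp: mult_MW one_MW)

lemma line_closed:
  assumes "line_meets l m x1 x2 x3" "x1 \<in> K" "l * x1 + m \<in> K" "x2 \<in> K" "l * x2 + m \<in> K"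
  shows "l \<in> K" "m \<in> K"
proof -
  show l: "l \<in> K"
    using slope_closed[OF assms(2-5)] by (simp add: slope_eq_if_line_meets(1)[OF assms(1)])
  show "m \<in> K" using diff_closed[OF assms(3) mult_closed[OF l assms(2)]] by simp
qed

end

section \<open>Two-descent\<close>

definition monic_poly :: "'a::comm_semiring_1 list \<Rightarrow> 'a \<Rightarrow> 'a" where
  "monic_poly cs x = horner_sum id x (cs @ [1])"

lemma monic_poly_simps [simp]: "monic_poly [] x = 1" "monic_poly (c # cs) x = c + x * monic_poly cs x"
  by (simp_all add: monic_poly_def)

text \<open>The monic quartic whose roots are the abscissas of the points \<open>R\<close> such that \<open>2R\<close> has abscissa \<open>x\<close>.\<close>

definition halving_quartic :: "'a::comm_ring_1 \<Rightarrow> 'a \<Rightarrow> 'a \<Rightarrow> 'a \<Rightarrow> 'a list" where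
  "halving_quartic a b c x = [b\<^sup>2 - 4 * a * c - 4 * c * x, - 8 * c - 4 * b * x, - 2 * b - 4 * a * x, - 4 * x]"

locale two_descent = elliptic_curve_subfield 0 a 0 b c K for a b c :: "'a::field" and K
begin

lemma two_nonzero: "(2::'a) \<noteq> 0"
proof
  assume "(2::'a) = 0"
  moreover have "discriminant E =
      2 * (- (8 * a\<^sup>2 * (4 * a * c - b\<^sup>2)) - 32 * b ^ 3 - 216 * c\<^sup>2 + 144 * a * b * c)"
    by (simp add: discriminant_def Let_def power2_eq_square power3_eq_cube algebra_simps)
  ultimately show False using discriminant_nonzero by simp
qed

lemma derivative_nonzero:
  assumes "e ^ 3 + a * e\<^sup>2 + b * e + c = 0"
  shows "3 * e\<^sup>2 + 2 * a * e + b \<noteq> 0"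
  using nonsingular[of e 0] assms by simp

primrec kummer :: "'a \<Rightarrow> 'a point \<Rightarrow> 'a" where
  "kummer e Infinity = 1"
| "kummer e (Affine x y) = (if x = e then 3 * e\<^sup>2 + 2 * a * e + b else x - e)"

lemma kummer_neg_point [simp]: "kummer e (neg_point P) = kummer e P"
  by (cases P) simp_all

context
  fixes e
  assumes root: "e ^ 3 + a * e\<^sup>2 + b * e + c = 0" and e: "e \<in> K"
begin

lemma kummer_nonzero: "kummer e P \<noteq> 0"
  using derivative_nonzero[OF root] by (cases P) simp_all

lemma kummer_closed: "P \<in> carrier MW \<Longrightarrow> kummer e P \<in> K"
  using e coefficients by (cases P) (auto simp: carrier_MW intro!: field_closed)

lemma kummer_line_through_root:
  assumes meets: "line_meets l m e x2 x3"
  shows "kummer e (Affine e y1) * kummer e (Affine x2 y2) * kummer e (Affine x3 y3) =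
    (3 * e\<^sup>2 + 2 * a * e + b)\<^sup>2"
proof -
  have "l * e + m = 0" using line_meets_factor[OF meets refl, of e] root by simp
  then have derivative: "3 * e\<^sup>2 + 2 * a * e + b = (e - x2) * (e - x3)"
    using line_meets_derivative[OF meets refl, of e] by simp
  then have "x2 \<noteq> e" "x3 \<noteq> e" using derivative_nonzero[OF root] by auto
  then have "kummer e (Affine e y1) * kummer e (Affine x2 y2) * kummer e (Affine x3 y3) =
      (3 * e\<^sup>2 + 2 * a * e + b) * ((x2 - e) * (x3 - e))" by simp
  also have "(x2 - e) * (x3 - e) = 3 * e\<^sup>2 + 2 * a * e + b" unfolding derivative by (simp add: algebra_simps)
  finally show ?thesis by (simp only: power2_eq_square)
qed

lemma kummer_line:
  assumes meets: "line_meets l m x1 x2 x3"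
  shows "kummer e (Affine x1 y1) * kummer e (Affine x2 y2) * kummer e (Affine x3 y3) \<in>
    {(3 * e\<^sup>2 + 2 * a * e + b)\<^sup>2, (l * e + m)\<^sup>2}"
proof (cases "e \<in> {x1, x2, x3}")
  case True
  then consider (first) "x1 = e" | (second) "x2 = e" | (third) "x3 = e" by blast
  then show ?thesis
  proof cases
    case first
    then show ?thesis using kummer_line_through_root meets by blast
  next
    case second
    then show ?thesis
      using kummer_line_through_root[of l m x1 x3 y2 y1 y3] line_meets_permute(1)[OF meets]
      by (simp add: mult_ac del: kummer.simps)
  next
    case third
    then show ?thesis
      using kummer_line_through_root[of l m x1 x2 y3 y1 y2] line_meets_permute(4)[OF meets]
      by (simp add: mult_ac del: kummer.simps)
  qed
next
  case False
  have "(l * e + m)\<^sup>2 = (x1 - e) * (x2 - e) * (x3 - e)"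
    using line_meets_factor[OF meets refl, of e] root by (simp add: algebra_simps)
  then show ?thesis using False by auto
qed

lemma kummer_mult:
  assumes P: "P \<in> carrier MW" and Q: "Q \<in> carrier MW"
  obtains z where "z \<in> K" "z \<noteq> 0" "kummer e (P \<otimes>\<^bsub>MW\<^esub> Q) = z\<^sup>2 * (kummer e P * kummer e Q)"
proof -
  have "on_curve E P" "on_curve E Q" using P Q by (simp_all add: carrier_MW)
  then have "\<exists>z\<in>K. kummer e P * kummer e Q * kummer e (point_add E P Q) = z\<^sup>2"
  proof (cases rule: point_add_cases)
    case left_zero
    then show ?thesis using kummer_closed[OF Q]
      by (intro bexI[of _ "kummer e Q"]) (simp_all add: power2_eq_square)
  next
    case right_zero
    then show ?thesis using kummer_closed[OF P]
      by (intro bexI[of _ "kummer e P"]) (simp_all add: power2_eq_square)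
  next
    case opposite
    then show ?thesis using kummer_closed[OF P]
      by (intro bexI[of _ "kummer e P"]) (simp_all add: point_add_opposite power2_eq_square)
  next
    case (line l m x1 x2 x3)
    have "l \<in> K" "m \<in> K" using line_closed[OF line(1)] P Q line by (auto simp: carrier_MW)
    then have "l * e + m \<in> K" "3 * e\<^sup>2 + 2 * a * e + b \<in> K"
      using e coefficients by (auto intro!: field_closed)
    then show ?thesis
      using kummer_line[OF line(1)] unfolding line(4) unfolding kummer_neg_point line(2,3) by blast
  qed
  then obtain z where z: "z \<in> K" "kummer e P * kummer e Q * kummer e (P \<otimes>\<^bsub>MW\<^esub> Q) = z\<^sup>2"
    by (auto simp: mult_MW)
  show ?thesis
  proof (rule that)
    show "z / (kummer e P * kummer e Q) \<in> K" using z(1) kummer_closed P Q by (auto intro!: field_closed)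
    show "z / (kummer e P * kummer e Q) \<noteq> 0" using z(2) kummer_nonzero by auto
    show "kummer e (P \<otimes>\<^bsub>MW\<^esub> Q) = (z / (kummer e P * kummer e Q))\<^sup>2 * (kummer e P * kummer e Q)"
      using z(2) kummer_nonzero[of P] kummer_nonzero[of Q] by (simp add: field_simps power2_eq_square)
  qed
qed

lemma kummer_preimage:
  assumes mult: "\<And>x y. x \<in> U \<Longrightarrow> y \<in> U \<Longrightarrow> x * y \<in> U" and sq: "\<And>z. z \<in> K \<Longrightarrow> z \<noteq> 0 \<Longrightarrow> z\<^sup>2 \<in> U"
  shows "subgroup {P \<in> carrier MW. kummer e P \<in> U} MW" (is "subgroup ?N MW")
    and "MW.squares \<subseteq> {P \<in> carrier MW. kummer e P \<in> U}"
proof -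
  show "subgroup ?N MW"
  proof (rule MW.subgroupI)
    have "kummer e \<one>\<^bsub>MW\<^esub> \<in> U" using sq[of 1] one_closed by (simp add: one_MW)
    then show "?N \<noteq> {}" by blast
    show "inv\<^bsub>MW\<^esub> P \<in> ?N" if "P \<in> ?N" for P using that neg_point_MW by (simp add: inv_MW)
    show "P \<otimes>\<^bsub>MW\<^esub> Q \<in> ?N" if PQ: "P \<in> ?N" "Q \<in> ?N" for P Q
    proof -
      obtain z where "z \<in> K" "z \<noteq> 0" "kummer e (P \<otimes>\<^bsub>MW\<^esub> Q) = z\<^sup>2 * (kummer e P * kummer e Q)"
        using kummer_mult[of P Q] PQ by blast
      then show ?thesis using PQ mult sq by simp
    qed
  qed auto
  show "MW.squares \<subseteq> ?N"
  proof
    fix R assume "R \<in> MW.squares"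
    then obtain P where P: "P \<in> carrier MW" "R = P \<otimes>\<^bsub>MW\<^esub> P" by (auto simp: MW.squares_def)
    obtain z where z: "z \<in> K" "z \<noteq> 0" "kummer e R = z\<^sup>2 * (kummer e P * kummer e P)"
      using kummer_mult[OF P(1) P(1)] P(2) by blast
    have "(z * kummer e P)\<^sup>2 \<in> U" using z kummer_nonzero kummer_closed[OF P(1)] by (intro sq mult_closed) auto
    moreover have "kummer e R = (z * kummer e P)\<^sup>2" by (simp add: z(3) power2_eq_square)
    ultimately show "R \<in> ?N" using P by simp
  qed
qed

end

lemma two_torsion_point:
  assumes "P \<in> carrier MW" "P \<otimes>\<^bsub>MW\<^esub> P = \<one>\<^bsub>MW\<^esub>" "P \<noteq> \<one>\<^bsub>MW\<^esub>"
  obtains x where "P = Affine x 0" "x ^ 3 + a * x\<^sup>2 + b * x + c = 0" "x \<in> K"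
proof (cases P)
  case Infinity
  then show ?thesis using assms(3) by (simp add: one_MW)
next
  case (Affine x y)
  have "y = 0"
  proof (rule ccontr)
    assume "y \<noteq> 0"
    then have "\<not> (x = x \<and> y + y + 0 * x + 0 = 0)" using two_nonzero by (simp flip: mult_2)
    from point_add_slope[OF this refl refl] show False
      using assms(2) Affine by (simp add: mult_MW one_MW)
  qed
  then show ?thesis using that assms(1) Affine by (auto simp: carrier_MW)
qed

lemma point_double_eqI:
  assumes "y \<noteq> 0" "l * (2 * y) = 3 * x\<^sup>2 + 2 * a * x + b"
    and "x' = l\<^sup>2 - a - 2 * x" "y' = - (y + l * (x' - x))"
  shows "Affine x y \<otimes>\<^bsub>MW\<^esub> Affine x y = Affine x' y'"
proof -
  have "\<not> (x = x \<and> y + y + 0 * x + 0 = 0)" using assms(1) two_nonzero by (simp flip: mult_2)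
  moreover have "l = slope x y x y" using assms(1,2) two_nonzero by (simp add: slope_def field_simps)
  ultimately show ?thesis
    using point_add_slope[of x x y y l x'] assms(3,4) by (simp add: mult_MW)
qed

lemma point_add_eqI:
  assumes "x1 \<noteq> x2" "l * (x2 - x1) = y2 - y1"
    and "x3 = l\<^sup>2 - a - x1 - x2" "y3 = - (y1 + l * (x3 - x1))"
  shows "Affine x1 y1 \<otimes>\<^bsub>MW\<^esub> Affine x2 y2 = Affine x3 y3"
proof -
  have "l = slope x1 y1 x2 y2" using assms(1,2) by (simp add: slope_def field_simps)
  then show ?thesis
    using point_add_slope[of x1 x2 y1 y2 l x3] assms(1,3,4) by (simp add: mult_MW)
qed

lemma point_add_eq_one_imp_same_x:
  assumes "Affine x1 y1 \<otimes>\<^bsub>MW\<^esub> Affine x2 y2 = \<one>\<^bsub>MW\<^esub>"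
  shows "x1 = x2"
  using assms by (auto simp: mult_MW one_MW point_add.simps(3) Let_def split: if_splits)

lemma two_torsion_point_double: "Affine e 0 \<otimes>\<^bsub>MW\<^esub> Affine e 0 = \<one>\<^bsub>MW\<^esub>"
  using point_add_opposite[of "Affine e 0"] by (simp add: mult_MW one_MW)

lemma ord_two_torsion_point:
  assumes "Affine e 0 \<in> carrier MW"
  shows "MW.ord (Affine e 0) = 2"
  using assms two_torsion_point_double by (intro MW.ord_eq_2I) (simp_all add: one_MW)

lemma halving_quartic_root:
  assumes R: "Affine x y \<in> carrier MW" and double: "Affine x y \<otimes>\<^bsub>MW\<^esub> Affine x y = Affine x' y'"
  shows "monic_poly (halving_quartic a b c x') x = 0"
proof -
  have y: "y \<noteq> 0" using double two_torsion_point_double by (auto simp: one_MW)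
  define l where "l = (3 * x\<^sup>2 + 2 * a * x + b) / (2 * y)"
  have l: "l * (2 * y) = 3 * x\<^sup>2 + 2 * a * x + b" using y two_nonzero by (simp add: l_def)
  have x': "x' = l\<^sup>2 - a - 2 * x" using point_double_eqI[OF y l refl refl] double by simp
  have "y\<^sup>2 = x ^ 3 + a * x\<^sup>2 + b * x + c" using R by (simp add: carrier_MW)
  with l x' have "x ^ 4 - 4 * x' * x ^ 3 + (- 2 * b - 4 * a * x') * x\<^sup>2 + (- 8 * c - 4 * b * x') * x +
      (b\<^sup>2 - 4 * a * c - 4 * c * x') = 0"
    by Groebner_Basis.algebra
  then show ?thesis
    by (simp add: halving_quartic_def algebra_simps power2_eq_square power3_eq_cube power4_eq_xxxx)
qed

lemma not_square_if_halving_quartic_rootless: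
  assumes "\<And>z. z \<in> K \<Longrightarrow> monic_poly (halving_quartic a b c x) z \<noteq> 0"
  shows "Affine x y \<notin> MW.squares"
proof
  assume "Affine x y \<in> MW.squares"
  then obtain R where R: "R \<in> carrier MW" "Affine x y = R \<otimes>\<^bsub>MW\<^esub> R" by (auto simp: MW.squares_def)
  then obtain x1 y1 where "R = Affine x1 y1" by (cases R) (auto simp: mult_MW)
  then show False using R assms[of x1] halving_quartic_root[of x1 y1 x y] by (auto simp: carrier_MW)
qed

theorem has_subgroup_if_full_two_torsion:
  assumes roots: "a = - (e1 + e2 + e3)" "b = e1 * e2 + e1 * e3 + e2 * e3" "c = - (e1 * e2 * e3)" "e1 \<noteq> e2"
    and t: "MW.ord t = 2 * m" "m > 0" "t [^]\<^bsub>MW\<^esub> m = Affine e2 0"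
    and carrier: "set ([Affine e1 0, t] @ gs) \<subseteq> carrier MW"
    and ind: "MW.independent_mod_squares ([Affine e1 0, t] @ gs)"
  shows "has_subgroup_isomorphic_to MW
    (integer_mod_group 2 \<times>\<times> integer_mod_group (2 * m) \<times>\<times> free_abelian_group_of_rank (length gs))"
proof (rule MW.has_subgroup_isomorphic_to_two_cyclic_times_free[OF _ _ _ t(1,2) _ _ ind])
  show s: "Affine e1 0 \<in> carrier MW" and "t \<in> carrier MW" "set gs \<subseteq> carrier MW" using carrier by auto
  show "MW.ord (Affine e1 0) = 2" using s by (rule ord_two_torsion_point)
  show "Affine e1 0 \<noteq> t [^]\<^bsub>MW\<^esub> m" using t(3) roots(4) by simp
  have e3: "Affine e1 0 \<otimes>\<^bsub>MW\<^esub> t [^]\<^bsub>MW\<^esub> m = Affine e3 0"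
    unfolding t(3) using roots by (intro point_add_eqI[of _ _ 0]) auto
  fix P assume P: "P \<in> carrier MW" "P \<otimes>\<^bsub>MW\<^esub> P = \<one>\<^bsub>MW\<^esub>"
  show "P \<in> {\<one>\<^bsub>MW\<^esub>, Affine e1 0, t [^]\<^bsub>MW\<^esub> m, Affine e1 0 \<otimes>\<^bsub>MW\<^esub> t [^]\<^bsub>MW\<^esub> m}"
  proof (cases "P = \<one>\<^bsub>MW\<^esub>")
    case False
    then obtain x where x: "P = Affine x 0" "x ^ 3 + a * x\<^sup>2 + b * x + c = 0"
      using two_torsion_point[OF P] by blast
    have "(x - e1) * (x - e2) * (x - e3) = 0"
      using x(2) unfolding roots(1-3) by (simp add: algebra_simps power2_eq_square power3_eq_cube)
    then show ?thesis unfolding e3 unfolding t(3) using x(1) by auto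
  qed simp
qed

end

section \<open>Quadratic fields\<close>

lemma rat_square_eq_of_int_imp_square:
  fixes q :: rat
  assumes "q\<^sup>2 = of_int D"
  shows "\<exists>u. u\<^sup>2 = D"
proof -
  obtain u n where q: "quotient_of q = (u, n)" by (cases "quotient_of q")
  have n: "n > 0" "coprime u n" using q quotient_of_denom_pos quotient_of_coprime by blast+
  have "q = of_int u / of_int n" using q quotient_of_div by blast
  then have "of_int (u\<^sup>2) = (of_int (D * n\<^sup>2) :: rat)"
    using assms n by (simp add: power_divide divide_eq_eq)
  then have u: "u\<^sup>2 = D * n\<^sup>2" by (simp only: of_int_eq_iff)
  then have "n dvd u\<^sup>2" by (simp add: power2_eq_square)
  moreover have "coprime n (u\<^sup>2)" using n(2) by (simp add: coprime_commute)
  ultimately have "n dvd 1" using coprime_common_divisor[of n "u\<^sup>2" n] by simp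
  then have "n = 1" using n by simp
  then show ?thesis using u by auto
qed

lemma not_square_if_between_squares:
  fixes D k u :: int
  assumes "k \<ge> 0" "k\<^sup>2 < D" "D < (k + 1)\<^sup>2"
  shows "u\<^sup>2 \<noteq> D"
proof -
  have "\<bar>k\<bar> < \<bar>u\<bar> \<and> \<bar>u\<bar> < \<bar>k + 1\<bar>" if "u\<^sup>2 = D"
    using assms(2,3) that by (metis power2_less_imp_less abs_ge_zero power2_abs)
  then show ?thesis using assms(1) by fastforce
qed

definition quadratic_field :: "int \<Rightarrow> complex set" where
  "quadratic_field D = {of_rat p + of_rat q * csqrt (of_int D) |p q. True}"

locale quadratic =
  fixes D :: int
  assumes nonsquare: "u\<^sup>2 \<noteq> D"
begin

abbreviation "K \<equiv> quadratic_field D"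

definition quad :: "rat \<Rightarrow> rat \<Rightarrow> complex" where
  "quad p q = of_rat p + of_rat q * csqrt (of_int D)"

lemma quad_in_K [simp]: "quad p q \<in> K"
  by (auto simp: quadratic_field_def quad_def)

lemma K_cases:
  assumes "z \<in> K"
  obtains p q where "z = quad p q"
  using assms by (auto simp: quadratic_field_def quad_def)

lemma csqrt_not_rat: "csqrt (of_int D) \<notin> \<rat>"
proof
  assume "csqrt (of_int D) \<in> \<rat>"
  then obtain q where "of_rat q = csqrt (of_int D)" by (metis Rats_cases)
  then have "(of_rat q)\<^sup>2 = (of_int D :: complex)" using power2_csqrt by metis
  then have "of_rat (q\<^sup>2) = (of_rat (of_int D) :: complex)" by (simp add: of_rat_power)
  then have "q\<^sup>2 = of_int D" by (simp only: of_rat_eq_iff)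
  then show False using rat_square_eq_of_int_imp_square nonsquare by blast
qed

lemma quad_eq_iff: "quad p q = quad p' q' \<longleftrightarrow> p = p' \<and> q = q'"
proof
  assume eq: "quad p q = quad p' q'"
  have "q = q'"
  proof (rule ccontr)
    assume ne: "q \<noteq> q'"
    have "of_rat (q - q') * csqrt (of_int D) = of_rat (p' - p)"
      using eq by (simp add: quad_def of_rat_diff algebra_simps)
    then have "csqrt (of_int D) = of_rat ((p' - p) / (q - q'))"
      using ne by (simp add: of_rat_divide of_rat_diff field_simps)
    then show False using csqrt_not_rat by (metis Rats_of_rat)
  qed
  then show "p = p' \<and> q = q'" using eq by (simp add: quad_def)
qed simp

lemma quad_add: "quad p q + quad p' q' = quad (p + p') (q + q')"
  and quad_minus: "- quad p q = quad (- p) (- q)"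
  and quad_diff: "quad p q - quad p' q' = quad (p - p') (q - q')"
  by (simp_all add: quad_def of_rat_add of_rat_minus of_rat_diff algebra_simps)

lemma quad_mult: "quad p q * quad p' q' = quad (p * p' + of_int D * q * q') (p * q' + q * p')"
proof -
  have "quad p q * quad p' q' = of_rat p * of_rat p' + of_rat q * of_rat q' * (csqrt (of_int D))\<^sup>2 +
      (of_rat p * of_rat q' + of_rat q * of_rat p') * csqrt (of_int D)"
    by (simp add: quad_def power2_eq_square algebra_simps)
  then show ?thesis by (simp add: quad_def of_rat_add of_rat_mult algebra_simps)
qed

lemma numeral_quad: "numeral k = quad (numeral k) 0"
  and of_int_quad: "of_int n = quad (of_int n) 0"
  and one_quad: "1 = quad 1 0"
  and zero_quad: "0 = quad 0 0"
  by (simp_all add: quad_def)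

lemma quad_eq_0_iff: "quad p q = 0 \<longleftrightarrow> p = 0 \<and> q = 0" "0 = quad p q \<longleftrightarrow> p = 0 \<and> q = 0"
  unfolding zero_quad quad_eq_iff by auto

lemmas quad_simps = quad_add quad_minus quad_diff quad_mult numeral_quad quad_eq_iff quad_eq_0_iff
  power2_eq_square power3_eq_cube

lemma quad_norm_nonzero:
  fixes p q :: rat
  assumes "p \<noteq> 0 \<or> q \<noteq> 0"
  shows "p\<^sup>2 - of_int D * q\<^sup>2 \<noteq> 0"
proof
  assume eq: "p\<^sup>2 - of_int D * q\<^sup>2 = 0"
  show False
  proof (cases "q = 0")
    case False
    then have "(p / q)\<^sup>2 = of_int D" using eq by (simp add: field_simps)
    then show False using rat_square_eq_of_int_imp_square nonsquare by blast
  qed (use eq assms in auto)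
qed

lemma inverse_quad:
  "inverse (quad p q) = quad (p / (p\<^sup>2 - of_int D * q\<^sup>2)) (- q / (p\<^sup>2 - of_int D * q\<^sup>2))"
proof (cases "p = 0 \<and> q = 0")
  case False
  then have "p\<^sup>2 - of_int D * q\<^sup>2 \<noteq> 0" using quad_norm_nonzero by blast
  then have "quad p q * quad (p / (p\<^sup>2 - of_int D * q\<^sup>2)) (- q / (p\<^sup>2 - of_int D * q\<^sup>2)) = 1"
    unfolding quad_mult one_quad quad_eq_iff
    by (simp add: divide_simps) (simp add: power2_eq_square algebra_simps)
  then show ?thesis by (rule inverse_unique)
qed (simp add: zero_quad[symmetric])

sublocale subfield_of_type K
proof
  show "1 \<in> K" unfolding one_quad by (rule quad_in_K)
qed (auto elim!: K_cases simp: quad_diff quad_mult inverse_quad simp del: minus_divide_left)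

lemma dimension_quadratic_field: "ring.dimension (ring_of_type_algebra :: complex ring) 2 \<rat> K"
proof -
  let ?R = "ring_of_type_algebra :: complex ring" and ?w = "csqrt (of_int D)"
  interpret R: field ?R by (rule field_from_type_algebra)
  have line_extension: "R.line_extension \<rat> v A = {k * v + y |k y. k \<in> \<rat> \<and> y \<in> A}" for v A
    unfolding set_eq_iff R.line_extension_mem_iff by (auto simp: ring_of_type_algebra_def)
  have "R.line_extension \<rat> 1 {0} = \<rat>" by (auto simp: line_extension)
  moreover have "R.dimension 0 \<rat> {0}"
    using R.dimension.zero_dim[of \<rat>] by (simp add: ring_of_type_algebra_def)
  ultimately have "R.dimension (Suc 0) \<rat> \<rat>"
    using R.dimension.Suc_dim[of 1 "{0}" 0 \<rat>] by (simp add: ring_of_type_algebra_def)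
  then have "R.dimension 2 \<rat> (R.line_extension \<rat> ?w \<rat>)"
    unfolding numeral_2_eq_2 using csqrt_not_rat
    by (intro R.dimension.Suc_dim) (auto simp: ring_of_type_algebra_def)
  moreover have "R.line_extension \<rat> ?w \<rat> = K"
    unfolding line_extension quadratic_field_def by (fastforce elim!: Rats_cases intro: add.commute)
  ultimately show ?thesis by simp
qed

lemma quadratic_number_field: "quadratic_number_field K"
  unfolding quadratic_number_field_def using subfield_ring_of_type_algebra dimension_quadratic_field by blast

lemma integral_multiple:
  assumes "z \<in> K"
  obtains n u v where "n > 0" "of_int n * z = quad (of_int u) (of_int v)"
proof -
  obtain x y where z: "z = quad x y" using assms by (rule K_cases)
  obtain u k v m where x: "quotient_of x = (u, k)" and y: "quotient_of y = (v, m)" by fastforce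
  have "k > 0" "m > 0" using x y quotient_of_denom_pos by blast+
  moreover have "x = of_int u / of_int k" "y = of_int v / of_int m" using x y quotient_of_div by blast+
  ultimately have numerators: "of_int (k * m) * x = of_int (u * m)" "of_int (k * m) * y = of_int (v * k)"
    and "k * m > 0"
    by (simp_all add: field_simps)
  have "of_int (k * m) * z = quad (of_int (k * m) * x) (of_int (k * m) * y)"
    unfolding z of_int_quad quad_mult by simp
  with \<open>k * m > 0\<close> show ?thesis unfolding numerators by (rule that)
qed

end

section \<open>Reduction modulo split primes\<close>

lemma QuadRes_code:
  assumes "p > 0"
  shows "QuadRes p a \<longleftrightarrow> list_ex (\<lambda>t. t * t mod p = a mod p) [0..p - 1]"
proof
  assume "QuadRes p a"
  then obtain y where "[y\<^sup>2 = a] (mod p)" by (auto simp: QuadRes_def)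
  then have "(y mod p) * (y mod p) mod p = a mod p"
    by (simp add: cong_def power2_eq_square mod_mult_eq)
  moreover have "y mod p \<in> set [0..p - 1]" using assms by simp
  ultimately show "list_ex (\<lambda>t. t * t mod p = a mod p) [0..p - 1]" unfolding list_ex_iff by blast
qed (auto simp: list_ex_iff QuadRes_def cong_def power2_eq_square)

lemma Legendre_eq_1_iff: "Legendre a p = 1 \<longleftrightarrow> \<not> p dvd a \<and> QuadRes p a"
  by (auto simp: Legendre_def cong_0_iff)

text \<open>
  \<open>s\<close> selects the prime ideal of \<open>\<rat>(\<surd>D)\<close> above \<open>p\<close> that contains \<open>\<surd>D - s\<close>; the other one belongs to \<open>- s\<close>.
\<close>

locale split_prime = quadratic +
  fixes p s :: int
  assumes prime: "prime p" and odd: "odd p" and not_dvd: "\<not> p dvd D" and root: "[s\<^sup>2 = D] (mod p)"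
begin

definition reduces :: "complex \<Rightarrow> int \<Rightarrow> bool" where
  "reduces z r \<longleftrightarrow> (\<exists>n u v. \<not> p dvd n \<and> of_int n * z = quad (of_int u) (of_int v) \<and> [n * r = u + v * s] (mod p))"

definition p_integral :: "complex \<Rightarrow> bool" where
  "p_integral z \<longleftrightarrow> (\<exists>n u v. \<not> p dvd n \<and> of_int n * z = quad (of_int u) (of_int v))"

lemma reducesE:
  assumes "reduces z r"
  obtains n u v where "\<not> p dvd n" "of_int n * z = quad (of_int u) (of_int v)" "[n * r = u + v * s] (mod p)"
  using assms unfolding reduces_def by blast

lemma dvd_mult_iff: "p dvd x * y \<longleftrightarrow> p dvd x \<or> p dvd y"
  using prime by (simp add: prime_dvd_mult_iff)

lemma reduces_quad: "reduces (quad (of_int u) (of_int v)) (u + v * s)"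
  unfolding reduces_def using prime by (intro exI[of _ 1] exI[of _ u] exI[of _ v]) (auto dest: not_prime_unit)

lemma reduces_of_int: "reduces (of_int n) n"
  using reduces_quad[of n 0] by (simp add: of_int_quad)

lemma reduces_mult:
  assumes "reduces z r" "reduces z' r'"
  shows "reduces (z * z') (r * r')"
proof -
  obtain n u v where z: "\<not> p dvd n" "of_int n * z = quad (of_int u) (of_int v)" "[n * r = u + v * s] (mod p)"
    using assms(1) by (rule reducesE)
  obtain n' u' v' where z': "\<not> p dvd n'" "of_int n' * z' = quad (of_int u') (of_int v')"
    "[n' * r' = u' + v' * s] (mod p)"
    using assms(2) by (rule reducesE)
  have "of_int (n * n') * (z * z') = (of_int n * z) * (of_int n' * z')" by simp
  also have "\<dots> = quad (of_int (u * u' + D * v * v')) (of_int (u * v' + v * u'))"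
    unfolding z(2) z'(2) quad_mult by simp
  finally have "of_int (n * n') * (z * z') = quad (of_int (u * u' + D * v * v')) (of_int (u * v' + v * u'))" .
  moreover have "[n * n' * (r * r') = u * u' + D * v * v' + (u * v' + v * u') * s] (mod p)"
  proof -
    have "[(n * r) * (n' * r') = (u + v * s) * (u' + v' * s)] (mod p)" by (rule cong_mult[OF z(3) z'(3)])
    also have "(u + v * s) * (u' + v' * s) = u * u' + v * v' * s\<^sup>2 + (u * v' + v * u') * s"
      by (simp add: power2_eq_square algebra_simps)
    also have "[\<dots> = u * u' + v * v' * D + (u * v' + v * u') * s] (mod p)"
      by (intro cong_add cong_mult root cong_refl)
    finally show ?thesis by (simp add: mult_ac)
  qed
  moreover have "\<not> p dvd n * n'" using z(1) z'(1) dvd_mult_iff by simp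
  ultimately show ?thesis unfolding reduces_def by blast
qed

lemma reduces_add:
  assumes "reduces z r" "reduces z' r'"
  shows "reduces (z + z') (r + r')"
proof -
  obtain n u v where z: "\<not> p dvd n" "of_int n * z = quad (of_int u) (of_int v)" "[n * r = u + v * s] (mod p)"
    using assms(1) by (rule reducesE)
  obtain n' u' v' where z': "\<not> p dvd n'" "of_int n' * z' = quad (of_int u') (of_int v')"
    "[n' * r' = u' + v' * s] (mod p)"
    using assms(2) by (rule reducesE)
  have "of_int (n * n') * (z + z') = of_int n' * (of_int n * z) + of_int n * (of_int n' * z')"
    by (simp add: algebra_simps)
  also have "\<dots> = quad (of_int (n' * u + n * u')) (of_int (n' * v + n * v'))"
    unfolding z(2) z'(2) by (simp add: of_int_quad quad_mult quad_add)
  finally have "of_int (n * n') * (z + z') = quad (of_int (n' * u + n * u')) (of_int (n' * v + n * v'))" .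
  moreover have "[n * n' * (r + r') = n' * u + n * u' + (n' * v + n * v') * s] (mod p)"
    using cong_add[OF cong_scalar_left[OF z(3), of n'] cong_scalar_left[OF z'(3), of n]]
    by (simp add: algebra_simps)
  moreover have "\<not> p dvd n * n'" using z(1) z'(1) dvd_mult_iff by simp
  ultimately show ?thesis unfolding reduces_def by blast
qed

lemma reduces_uminus: "reduces z r \<Longrightarrow> reduces (- z) (- r)"
  using reduces_mult[OF reduces_of_int[of "- 1"], of z r] by simp

lemma reduces_diff: "reduces z r \<Longrightarrow> reduces z' r' \<Longrightarrow> reduces (z - z') (r - r')"
  using reduces_add[OF _ reduces_uminus] by fastforce

lemma reduces_numeral: "reduces (numeral k) (numeral k)"
  using reduces_of_int[of "numeral k"] by simp

lemma reduces_one: "reduces 1 1"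
  using reduces_of_int[of 1] by simp

lemma reduces_power: "reduces z r \<Longrightarrow> reduces (z ^ k) (r ^ k)"
  by (induction k) (auto intro: reduces_one reduces_mult)

lemma reduces_cong:
  assumes "reduces z r" "[r = r'] (mod p)"
  shows "reduces z r'"
  using assms unfolding reduces_def by (meson cong_scalar_left cong_sym cong_trans)

lemma reduces_quad_cong: "[u + v * s = r] (mod p) \<Longrightarrow> reduces (quad (of_int u) (of_int v)) r"
  using reduces_cong reduces_quad by blast

lemma reduces_unique:
  assumes "reduces z r" "reduces z r'"
  shows "[r = r'] (mod p)"
proof -
  have "reduces 0 (r - r')" using reduces_diff[OF assms] by simp
  then obtain n u v where n: "\<not> p dvd n"
    and "quad (of_int u) (of_int v) = 0" "[n * (r - r') = u + v * s] (mod p)"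
    by (auto elim: reducesE)
  then have "[n * (r - r') = 0] (mod p)" by (simp add: quad_eq_0_iff)
  then show ?thesis using n dvd_mult_iff by (simp add: cong_0_iff cong_iff_dvd_diff)
qed

lemma reduces_0_iff: "reduces 0 r \<longleftrightarrow> p dvd r"
  using reduces_of_int[of 0] reduces_unique[of 0 r 0] reduces_cong[of 0 0 r]
  by (auto simp: cong_0_iff cong_sym_eq[of 0])

lemma reduces_monic_poly:
  assumes "list_all2 reduces cs rs" "reduces z r"
  shows "reduces (monic_poly cs z) (monic_poly rs r)"
  using assms(1)
  by (induction rule: list_all2_induct) (auto intro: reduces_one reduces_add reduces_mult assms(2))

lemma split_prime_conj: "split_prime D p (- s)"
  using prime odd not_dvd root by unfold_locales auto

lemma p_integral_iff_reduces: "p_integral z \<longleftrightarrow> (\<exists>r. reduces z r)"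
proof
  assume "p_integral z"
  then obtain n u v where n: "\<not> p dvd n" "of_int n * z = quad (of_int u) (of_int v)"
    unfolding p_integral_def by blast
  have "coprime n p" using prime_imp_coprime[OF prime n(1)] by (simp add: coprime_commute)
  then obtain i where "[n * i = 1] (mod p)" using cong_solve_coprime_int by blast
  then have "[n * (i * (u + v * s)) = u + v * s] (mod p)"
    using cong_scalar_right[of "n * i" 1 p "u + v * s"] by (simp add: mult.assoc)
  then show "\<exists>r. reduces z r" using n unfolding reduces_def by blast
qed (auto simp: reduces_def p_integral_def)

lemma p_integral_of_int: "p_integral (of_int k)"
  and p_integral_add: "p_integral z \<Longrightarrow> p_integral z' \<Longrightarrow> p_integral (z + z')"
  and p_integral_mult: "p_integral z \<Longrightarrow> p_integral z' \<Longrightarrow> p_integral (z * z')"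
  and p_integral_power: "p_integral z \<Longrightarrow> p_integral (z ^ j)"
  unfolding p_integral_iff_reduces
  using reduces_of_int reduces_add reduces_mult reduces_power by blast+

lemma scaled_monic_poly:
  assumes cs: "\<forall>c\<in>set cs. p_integral c" and y: "y = of_int n * z" "p_integral y"
  shows "\<exists>w. p_integral w \<and> of_int n ^ length cs * monic_poly cs z = y ^ length cs + of_int n * w"
  using cs
proof (induction cs)
  case Nil
  then show ?case using p_integral_of_int[of 0] by auto
next
  case (Cons c cs)
  then obtain w where w: "p_integral w" "of_int n ^ length cs * monic_poly cs z = y ^ length cs + of_int n * w"
    by auto
  have "of_int n ^ length (c # cs) * monic_poly (c # cs) z =
      of_int n * of_int n ^ length cs * c + y * (of_int n ^ length cs * monic_poly cs z)"
    by (simp add: y(1) algebra_simps)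
  also have "\<dots> = y ^ length (c # cs) + of_int n * (of_int n ^ length cs * c + y * w)"
    unfolding w(2) by (simp add: algebra_simps)
  finally have "of_int n ^ length (c # cs) * monic_poly (c # cs) z =
      y ^ length (c # cs) + of_int n * (of_int n ^ length cs * c + y * w)" .
  moreover have "p_integral (of_int n ^ length cs * c + y * w)"
    using Cons.prems y(2) w(1)
    by (intro p_integral_add p_integral_mult p_integral_power p_integral_of_int) auto
  ultimately show ?case by blast
qed

lemma dvd_numerator_of_monic_root:
  assumes cs: "\<forall>c\<in>set cs. p_integral c" and zero: "monic_poly cs z = 0"
    and n: "p dvd n" "of_int n * z = quad (of_int u) (of_int v)"
  shows "p dvd u + v * s"
proof -
  define y where "y = quad (of_int u) (of_int v)"
  have y: "y = of_int n * z" "reduces y (u + v * s)" using n(2) reduces_quad by (simp_all add: y_def)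
  obtain w r where w: "reduces w r" "of_int n ^ length cs * monic_poly cs z = y ^ length cs + of_int n * w"
    using scaled_monic_poly[OF cs y(1)] y(2) p_integral_iff_reduces by blast
  have "reduces (y ^ length cs + of_int n * w) ((u + v * s) ^ length cs + n * r)"
    by (intro reduces_add reduces_mult reduces_power reduces_of_int w(1) y(2))
  then have "p dvd (u + v * s) ^ length cs + n * r"
    using w(2) zero by (simp flip: reduces_0_iff)
  then have "p dvd (u + v * s) ^ length cs" using n(1) by (simp add: dvd_add_left_iff)
  then show ?thesis using prime prime_dvd_power by blast
qed

text \<open>
  If \<open>p\<close> divides a denominator \<open>n\<close> of \<open>z\<close>, then \<open>n z\<close> vanishes modulo both primes above \<open>p\<close>, so \<open>p\<close> divides
  both coordinates of \<open>n z\<close> and cancels; one prime alone would not control them.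
\<close>

theorem p_integral_if_monic_root:
  assumes z: "z \<in> K" and cs: "\<forall>c\<in>set cs. p_integral c" and zero: "monic_poly cs z = 0"
  shows "p_integral z"
proof -
  interpret conj: split_prime D p "- s" by (rule split_prime_conj)
  have "p_integral z" if "n > 0" "of_int n * z = quad (of_int u) (of_int v)" for n u v
    using that
  proof (induction "nat n" arbitrary: n u v rule: less_induct)
    case less
    show ?case
    proof (cases "p dvd n")
      case False
      then show ?thesis using less.prems unfolding p_integral_def by blast
    next
      case True
      have sum: "p dvd u + v * s" and diff: "p dvd u - v * s"
        using dvd_numerator_of_monic_root[OF cs zero True less.prems(2)]
          conj.dvd_numerator_of_monic_root[OF cs zero True less.prems(2)] by simp_all
      have "p dvd 2 * (v * s)" using dvd_diff[OF sum diff] by (simp add: algebra_simps)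
      moreover have "\<not> p dvd 2" using prime odd zdvd_imp_le[of p 2] prime_ge_2_int[of p] by fastforce
      moreover have "\<not> p dvd s" using not_dvd root by (auto simp: power2_eq_square dest: cong_dvd_iff)
      ultimately have "p dvd v" using dvd_mult_iff by blast
      moreover from this have "p dvd u" using sum by (simp add: dvd_add_left_iff)
      ultimately obtain n' u' v' where n': "n = p * n'" "u = p * u'" "v = p * v'"
        using True by (auto elim!: dvdE)
      have "of_int p * (of_int n' * z) = quad (of_int u) (of_int v)"
        using less.prems(2) by (simp add: n'(1) mult.assoc)
      also have "\<dots> = of_int p * quad (of_int u') (of_int v')" by (simp add: n'(2,3) of_int_quad quad_mult)
      finally have "of_int n' * z = quad (of_int u') (of_int v')" using prime by auto
      moreover have "n' > 0" "n' < n"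
        using less.prems(1) n'(1) prime_gt_1_int[OF prime] by (auto simp: zero_less_mult_iff)
      ultimately show ?thesis using less.hyps[of n'] by simp
    qed
  qed
  then show ?thesis using integral_multiple[OF z] by metis
qed

lemma monic_poly_rootless:
  assumes "list_all2 reduces cs rs" "list_all (\<lambda>r. \<not> p dvd monic_poly rs r) [0..p - 1]" "z \<in> K"
  shows "monic_poly cs z \<noteq> 0"
proof
  assume zero: "monic_poly cs z = 0"
  have "\<forall>c\<in>set cs. p_integral c"
    using assms(1) p_integral_iff_reduces by (metis list_all2_conv_all_nth in_set_conv_nth)
  then obtain r where "reduces z r" using p_integral_if_monic_root assms(3) zero p_integral_iff_reduces by blast
  then have "reduces z (r mod p)" by (rule reduces_cong) (simp add: cong_def)
  then have "p dvd monic_poly rs (r mod p)"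
    using reduces_monic_poly[OF assms(1)] zero reduces_0_iff by metis
  moreover have "r mod p \<in> set [0..p - 1]" using prime_gt_0_int[OF prime] by simp
  ultimately show False using assms(2) unfolding list_all_iff by blast
qed

lemma reduces_halving_quartic:
  assumes "reduces a ra" "reduces b rb" "reduces c rc" "reduces x rx"
  shows "list_all2 reduces (halving_quartic a b c x) (halving_quartic ra rb rc rx)"
  using assms unfolding halving_quartic_def
  by (auto intro!: reduces_diff reduces_mult reduces_power reduces_uminus reduces_numeral)

lemma QuadRes_if_reduces_square:
  assumes "z \<in> K" "reduces (z\<^sup>2) r"
  shows "QuadRes p r"
proof -
  have "monic_poly [- (z\<^sup>2), 0] z = 0" by (simp add: power2_eq_square)
  moreover have "\<forall>c\<in>set [- (z\<^sup>2), 0]. p_integral c"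
    using reduces_uminus[OF assms(2)] reduces_0_iff by (auto simp: p_integral_iff_reduces)
  ultimately obtain t where "reduces z t"
    using p_integral_if_monic_root assms(1) p_integral_iff_reduces by blast
  then have "[t\<^sup>2 = r] (mod p)" using reduces_unique reduces_power assms(2) by blast
  then show ?thesis unfolding QuadRes_def by blast
qed

lemma QuadRes_mult_square_iff:
  assumes "\<not> p dvd r"
  shows "QuadRes p (r\<^sup>2 * q) \<longleftrightarrow> QuadRes p q"
proof
  assume "QuadRes p q"
  then obtain t where "[t\<^sup>2 = q] (mod p)" unfolding QuadRes_def by blast
  then have "[(r * t)\<^sup>2 = r\<^sup>2 * q] (mod p)" by (simp add: power_mult_distrib cong_scalar_left)
  then show "QuadRes p (r\<^sup>2 * q)" unfolding QuadRes_def by blast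
next
  assume "QuadRes p (r\<^sup>2 * q)"
  then obtain t where t: "[t\<^sup>2 = r\<^sup>2 * q] (mod p)" unfolding QuadRes_def by blast
  have "coprime r p" using prime_imp_coprime[OF prime assms] by (simp add: coprime_commute)
  then obtain i where i: "[r * i = 1] (mod p)" using cong_solve_coprime_int by blast
  have "[(t * i)\<^sup>2 = (r * i)\<^sup>2 * q] (mod p)"
    using cong_scalar_right[OF t, of "i\<^sup>2"] by (simp add: power_mult_distrib mult_ac)
  also have "[(r * i)\<^sup>2 * q = 1\<^sup>2 * q] (mod p)" by (intro cong_mult cong_pow i cong_refl)
  finally show "QuadRes p q" unfolding QuadRes_def by auto
qed

text \<open>The nonzero elements of \<open>K\<close> that are squares in the completion at the prime.\<close>

definition local_squares :: "complex set" where
  "local_squares = {x. \<exists>z\<in>K. \<exists>r. z \<noteq> 0 \<and> \<not> p dvd r \<and> reduces (z\<^sup>2 * x) (r\<^sup>2)}"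

lemma local_squares_mult:
  assumes "x \<in> local_squares" "x' \<in> local_squares"
  shows "x * x' \<in> local_squares"
proof -
  obtain z r z' r' where z: "z \<in> K" "z \<noteq> 0" "\<not> p dvd r" "reduces (z\<^sup>2 * x) (r\<^sup>2)"
    and z': "z' \<in> K" "z' \<noteq> 0" "\<not> p dvd r'" "reduces (z'\<^sup>2 * x') (r'\<^sup>2)"
    using assms unfolding local_squares_def by blast
  have "reduces ((z * z')\<^sup>2 * (x * x')) ((r * r')\<^sup>2)"
    using reduces_mult[OF z(4) z'(4)] by (simp add: power_mult_distrib mult_ac)
  moreover have "z * z' \<in> K" "z * z' \<noteq> 0" "\<not> p dvd r * r'"
    using z z' mult_closed dvd_mult_iff by auto
  ultimately show ?thesis unfolding local_squares_def by blast
qed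

lemma square_in_local_squares:
  assumes "z \<in> K" "z \<noteq> 0"
  shows "z\<^sup>2 \<in> local_squares"
proof -
  have "reduces ((inverse z)\<^sup>2 * z\<^sup>2) (1\<^sup>2)" using assms(2) reduces_one by (simp flip: power_mult_distrib)
  moreover have "inverse z \<in> K" "inverse z \<noteq> 0" "\<not> p dvd 1" using assms inverse_closed prime by auto
  ultimately show ?thesis unfolding local_squares_def by blast
qed

lemma local_square_iff_Legendre:
  assumes n: "n \<noteq> 0" "of_int n ^ 2 * x = quad (of_int u) (of_int v)" and unit: "\<not> p dvd u + v * s"
  shows "x \<in> local_squares \<longleftrightarrow> Legendre (u + v * s) p = 1"
proof
  assume "x \<in> local_squares"
  then obtain z r where z: "z \<in> K" "z \<noteq> 0" "\<not> p dvd r" "reduces (z\<^sup>2 * x) (r\<^sup>2)"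
    unfolding local_squares_def by blast
  have "reduces ((z\<^sup>2 * x) * (of_int n ^ 2 * x)) (r\<^sup>2 * (u + v * s))"
    unfolding n(2) by (rule reduces_mult[OF z(4) reduces_quad])
  then have "reduces ((z * of_int n * x)\<^sup>2) (r\<^sup>2 * (u + v * s))"
    by (simp add: power_mult_distrib power2_eq_square mult_ac)
  moreover have "z * of_int n * x \<in> K"
  proof -
    have "z * of_int n * x = z * (of_int n ^ 2 * x) / of_int n" using n(1) by (simp add: power2_eq_square)
    also have "\<dots> \<in> K" unfolding n(2) using z(1) by (intro divide_closed mult_closed of_int_closed) simp_all
    finally show ?thesis .
  qed
  ultimately have "QuadRes p (u + v * s)" using QuadRes_if_reduces_square QuadRes_mult_square_iff z(3) by blast
  with unit show "Legendre (u + v * s) p = 1" by (simp add: Legendre_eq_1_iff)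
next
  assume "Legendre (u + v * s) p = 1"
  then obtain t where t: "[t\<^sup>2 = u + v * s] (mod p)" by (auto simp: Legendre_eq_1_iff QuadRes_def)
  then have "reduces (of_int n ^ 2 * x) (t\<^sup>2)" unfolding n(2) by (intro reduces_quad_cong cong_sym[OF t])
  moreover have "\<not> p dvd t" using t unit by (auto simp: power2_eq_square cong_dvd_iff dest: cong_dvd_iff)
  ultimately show "x \<in> local_squares"
    using n(1) of_int_closed[of n] unfolding local_squares_def by (auto intro!: bexI[of _ "of_int n"])
qed

end

text \<open>A triple \<open>(n, u, v)\<close> stands for \<open>(u + v \<surd>D) / n\<^sup>2\<close>.\<close>

definition legendre_symbols :: "int \<Rightarrow> int \<Rightarrow> (int \<times> int \<times> int) list \<Rightarrow> int list" where
  "legendre_symbols p s ds = map (\<lambda>(n, u, v). Legendre (u + v * s) p) ds"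

lemma legendre_symbols_code:
  assumes "p > 0"
  shows "legendre_symbols p s ds = map (\<lambda>(n, u, v). let r = (u + v * s) mod p in
    if r = 0 then 0 else if list_ex (\<lambda>t. t * t mod p = r) [0..p - 1] then 1 else - 1) ds"
  using QuadRes_code[OF assms] unfolding legendre_symbols_def Legendre_def
  by (auto simp: Let_def cong_def)

locale quadratic_descent = quadratic D + two_descent a b c "quadratic_field D" for D a b c
begin

definition kummer_values :: "complex \<Rightarrow> complex point list \<Rightarrow> (int \<times> int \<times> int) list \<Rightarrow> bool" where
  "kummer_values e gs ds \<longleftrightarrow> e \<in> K \<and> e ^ 3 + a * e\<^sup>2 + b * e + c = 0 \<and>
     list_all2 (\<lambda>P (n, u, v). n \<noteq> 0 \<and> of_int n ^ 2 * kummer e P = quad (of_int u) (of_int v)) gs ds"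

lemma separating_subgroup:
  assumes "split_prime D p s" and gs: "set gs \<subseteq> carrier MW" and kummer: "kummer_values e gs ds"
    and k: "k < length gs" and symbols: "legendre_symbols p s (drop k ds) =
      - 1 # replicate (length gs - Suc k) 1"
  shows "\<exists>N. subgroup N MW \<and> MW.squares \<subseteq> N \<and> gs ! k \<notin> N \<and> (\<forall>i<length gs. k < i \<longrightarrow> gs ! i \<in> N)"
proof -
  interpret split_prime D p s by fact
  let ?N = "{P \<in> carrier MW. kummer e P \<in> local_squares}"
  have length: "length ds = length gs"
    using kummer unfolding kummer_values_def by (auto dest: list_all2_lengthD)
  have member: "gs ! i \<in> ?N \<longleftrightarrow> k < i" if i: "k \<le> i" "i < length gs" for i
  proof -
    obtain n u v where ds: "ds ! i = (n, u, v)" by (cases "ds ! i")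
    have "legendre_symbols p s (drop k ds) ! (i - k) = Legendre (u + v * s) p"
      using i length ds by (simp add: legendre_symbols_def)
    then have symbol: "Legendre (u + v * s) p = (if k < i then 1 else - 1)"
      using i by (auto simp: symbols nth_Cons')
    have "n \<noteq> 0 \<and> of_int n ^ 2 * kummer e (gs ! i) = quad (of_int u) (of_int v)"
      using kummer i(2) ds list_all2_nthD unfolding kummer_values_def by fastforce
    moreover have "\<not> p dvd u + v * s"
      using symbol by (auto simp: Legendre_def cong_0_iff split: if_splits)
    ultimately have "kummer e (gs ! i) \<in> local_squares \<longleftrightarrow> k < i"
      using local_square_iff_Legendre[of n "kummer e (gs ! i)" u v] symbol by simp
    moreover have "gs ! i \<in> carrier MW" using gs i(2) by auto
    ultimately show ?thesis by simp
  qed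
  have "subgroup ?N MW" "MW.squares \<subseteq> ?N"
    using kummer local_squares_mult square_in_local_squares unfolding kummer_values_def
    by (intro kummer_preimage; blast)+
  then show ?thesis using member k by (intro exI[of _ ?N]) auto
qed

end

section \<open>The four curves\<close>

context
begin

interpretation quadratic "- 7"
proof
  show "u\<^sup>2 \<noteq> - 7" for u :: int using zero_le_power2[of u] by linarith
qed

private abbreviation "a15 \<equiv> quad 141 (- 44)"
private abbreviation "b15 \<equiv> quad 1232 (- 3344)"
private abbreviation "c15 \<equiv> quad (- 72576) 11648"

interpretation quadratic_descent "- 7" a15 b15 c15
proof unfold_locales
  show "discriminant (Weierstrass 0 a15 0 b15 c15) \<noteq> 0"
    by (simp add: discriminant_def Let_def quad_simps)
qed (simp_all add: zero_closed)

private abbreviation "T15 \<equiv> Affine 0 (quad (- 56) (- 104))"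
private abbreviation "P15 \<equiv> Affine (quad (- 112) 32) (quad 504 152)"

private lemma carrier_15: "T15 \<in> carrier MW" "P15 \<in> carrier MW"
  unfolding carrier_MW by (simp_all add: zero_closed quad_simps)

private lemma ord_T15: "MW.ord T15 = 15"
proof (rule MW.ord_eqI[OF carrier_15(1)])
  let ?T2 = "Affine (quad 56 104) (quad 672 (- 1568))" and ?T4 = "Affine (quad (- 28) 36) (quad 28 (- 212))"
    and ?T8 = "Affine (quad (- 84) 20) (quad (- 140) (- 84))"
  note add = MW.nat_pow_add_eq[OF carrier_15(1)]
  have T1: "T15 [^]\<^bsub>MW\<^esub> (1::nat) = T15" using carrier_15 by simp
  have T2: "T15 [^]\<^bsub>MW\<^esub> (2::nat) = ?T2"
    by (rule add[OF T1 T1 point_double_eqI[of _ "quad 15 2"]]) (simp_all add: quad_simps)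
  have T4: "T15 [^]\<^bsub>MW\<^esub> (4::nat) = ?T4"
    by (rule add[OF T2 T2 point_double_eqI[of _ "quad (- 20) (- 5)"]]) (simp_all add: quad_simps)
  have T8: "T15 [^]\<^bsub>MW\<^esub> (8::nat) = ?T8"
    by (rule add[OF T4 T4 point_double_eqI[of _ "quad (- 8) (- 3)"]]) (simp_all add: quad_simps)
  have T16: "T15 [^]\<^bsub>MW\<^esub> (16::nat) = T15"
    by (rule add[OF T8 T8 point_double_eqI[of _ "quad (- 1) 2"]]) (simp_all add: quad_simps)
  then have "T15 [^]\<^bsub>MW\<^esub> (15::nat) \<otimes>\<^bsub>MW\<^esub> T15 = T15" using add[OF refl T1 refl, of 16 15] by simp
  then show "T15 [^]\<^bsub>MW\<^esub> (15::nat) = \<one>\<^bsub>MW\<^esub>"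
    by (metis MW.nat_pow_closed MW.r_cancel_one carrier_15(1))
  have "T15 [^]\<^bsub>MW\<^esub> (5::nat) \<noteq> \<one>\<^bsub>MW\<^esub>" "T15 [^]\<^bsub>MW\<^esub> (3::nat) \<noteq> \<one>\<^bsub>MW\<^esub>"
    using add[OF T4 T1 refl, of 5] add[OF T2 T1 refl, of 3]
    by (auto dest: point_add_eq_one_imp_same_x simp: quad_simps)
  moreover have "prime_factors (15::nat) = {3, 5}"
    using prime_factors_product[of 3 "5::nat"] by (simp add: prime_prime_factors insert_commute)
  ultimately show "T15 [^]\<^bsub>MW\<^esub> (15 div q) \<noteq> \<one>\<^bsub>MW\<^esub>" if "q \<in> prime_factors 15" for q :: nat
    using that by auto
qed simp

private lemma not_square_P15: "P15 \<notin> MW.squares"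
proof (rule not_square_if_halving_quartic_rootless)
  interpret split_prime "- 7" 23 4 by unfold_locales (simp_all add: cong_def)
  have "reduces a15 11" "reduces b15 0" "reduces c15 6" "reduces (quad (- 112) 32) 16"
    using reduces_quad_cong[of 141 "- 44" 11] reduces_quad_cong[of 1232 "- 3344" 0]
      reduces_quad_cong[of "- 72576" 11648 6] reduces_quad_cong[of "- 112" 32 16]
    by (simp_all add: cong_def)
  note quartic = reduces_halving_quartic[OF this]
  have "list_all (\<lambda>r. \<not> 23 dvd monic_poly (halving_quartic 11 0 6 16) r) [0..23 - 1::int]" by code_simp
  then show "monic_poly (halving_quartic a15 b15 c15 (quad (- 112) 32)) z \<noteq> 0" if "z \<in> K" for z
    using monic_poly_rootless[OF quartic] that by blast
qed

private lemma two_torsion_15: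
  assumes "P \<in> carrier MW" "P \<otimes>\<^bsub>MW\<^esub> P = \<one>\<^bsub>MW\<^esub>"
  shows "P = \<one>\<^bsub>MW\<^esub>"
proof (rule ccontr)
  assume "P \<noteq> \<one>\<^bsub>MW\<^esub>"
  with assms obtain x where x: "x \<in> K" "x ^ 3 + a15 * x\<^sup>2 + b15 * x + c15 = 0"
    using two_torsion_point by blast
  interpret split_prime "- 7" 11 9 by unfold_locales (simp_all add: cong_def)
  have "list_all2 reduces [c15, b15, a15] [4, 0, 9]"
    using reduces_quad_cong[of "- 72576" 11648 4] reduces_quad_cong[of 1232 "- 3344" 0]
      reduces_quad_cong[of 141 "- 44" 9]
    by (simp add: cong_def)
  moreover have "list_all (\<lambda>r. \<not> 11 dvd monic_poly [4, 0, 9] r) [0..11 - 1::int]" by code_simp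
  ultimately have "monic_poly [c15, b15, a15] x \<noteq> 0"
    using x(1) by (rule monic_poly_rootless)
  with x(2) show False by (simp add: power2_eq_square power3_eq_cube algebra_simps)
qed

theorem torsion_15_rank_1:
  "\<exists>K E. quadratic_number_field K \<and> elliptic_curve_over K E \<and>
     has_subgroup_isomorphic_to (mordell_weil_group E K) (integer_mod_group 15 \<times>\<times> integer_group)"
proof -
  have independent: "MW.independent_mod_squares ([] @ [P15])"
  proof (rule MW.independent_mod_squares_if_separated)
    show "\<exists>N. subgroup N MW \<and> MW.squares \<subseteq> N \<and> ([] @ [P15]) ! k \<notin> N \<and>
        (\<forall>i<length ([] @ [P15]). k < i \<longrightarrow> ([] @ [P15]) ! i \<in> N)"
      if "k < length ([] @ [P15])" for k
      using that not_square_P15 MW.subgroup_squares by (intro exI[of _ MW.squares]) simp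
  qed (simp add: carrier_15)
  have two_torsion: "\<exists>c. P = MW.combination [] c" if "P \<in> carrier MW" "P \<otimes>\<^bsub>MW\<^esub> P = \<one>\<^bsub>MW\<^esub>" for P
    using two_torsion_15[OF that] by simp
  have "has_subgroup_isomorphic_to MW (integer_mod_group 15 \<times>\<times> free_abelian_group_of_rank (length [P15]))"
    by (rule MW.has_subgroup_isomorphic_to_cyclic_times_free
        [OF _ _ independent two_torsion carrier_15(1) ord_T15])
      (simp_all add: carrier_15)
  then have "has_subgroup_isomorphic_to MW (integer_mod_group 15 \<times>\<times> free_abelian_group_of_rank 1)" by simp
  moreover have "integer_mod_group 15 \<times>\<times> free_abelian_group_of_rank 1 \<cong> integer_mod_group 15 \<times>\<times> integer_group"
    by (intro group.DirProd_iso_trans iso_refl free_abelian_group_of_rank_1_iso) simp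
  ultimately show ?thesis
    using quadratic_number_field elliptic_curve_over has_subgroup_isomorphic_to_iso by blast
qed

end

context
begin

interpretation quadratic 26521
proof
  show "u\<^sup>2 \<noteq> 26521" for u :: int by (rule not_square_if_between_squares[of 162]) simp_all
qed

private abbreviation "a18 \<equiv> quad (- 2522790002) 19969314"
private abbreviation "b18 \<equiv> quad 4168469879014423688 (- 25596539667315992)"

interpretation quadratic_descent 26521 a18 b18 0
proof unfold_locales
  show "discriminant (Weierstrass 0 a18 0 b18 0) \<noteq> 0"
    by (simp add: discriminant_def Let_def quad_simps)
qed (simp_all add: zero_closed)

private abbreviation "T18 \<equiv> Affine (quad 1432571522 (- 8796518)) (quad (- 397485556320) 2434501920)"
private abbreviation "P18 \<equiv> Affine (quad 141523202 (- 2308838)) (quad 29563720345440 (- 149510207520))"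
private abbreviation "Q18 \<equiv> Affine (quad 190580690 (- 990806)) (quad 23379822662400 (- 148507142400))"

private lemma carrier_18: "set [T18, P18, Q18] \<subseteq> carrier MW" "T18 \<in> carrier MW"
  unfolding carrier_MW by (simp_all add: quad_simps)

private lemma T18_powers:
  "T18 [^]\<^bsub>MW\<^esub> (9::nat) = Affine 0 0"
  "T18 [^]\<^bsub>MW\<^esub> (6::nat) \<noteq> \<one>\<^bsub>MW\<^esub>"
proof -
  let ?T2 = "Affine (quad 3255899762 (- 19963958)) (quad (- 145927218542400) 896853758400)"
    and ?T4 = "Affine (quad 1695463922 (- 10410998)) (quad (- 14651667679680) 89970045120)"
    and ?T8 = "Affine (quad 1518473762 (- 8543558)) (quad (- 2263426485600) (- 8947269600))"
  note add = MW.nat_pow_add_eq[OF carrier_18(2)]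
  have T1: "T18 [^]\<^bsub>MW\<^esub> (1::nat) = T18" using carrier_18 by simp
  have T2: "T18 [^]\<^bsub>MW\<^esub> (2::nat) = ?T2"
    by (rule add[OF T1 T1 point_double_eqI[of _ "quad 26648 (- 330)"]]) (simp_all add: quad_simps)
  have T4: "T18 [^]\<^bsub>MW\<^esub> (4::nat) = ?T4"
    by (rule add[OF T2 T2 point_double_eqI[of _ "quad (- 37962) 400"]]) (simp_all add: quad_simps)
  have T8: "T18 [^]\<^bsub>MW\<^esub> (8::nat) = ?T8"
    by (rule add[OF T4 T4 point_double_eqI[of _ "quad (- 16660) 282"]]) (simp_all add: quad_simps)
  show "T18 [^]\<^bsub>MW\<^esub> (9::nat) = Affine 0 0"
    by (rule add[OF T8 T1 point_add_eqI[of _ _ "quad (- 14771) (- 89)"]]) (simp_all add: quad_simps)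
  show "T18 [^]\<^bsub>MW\<^esub> (6::nat) \<noteq> \<one>\<^bsub>MW\<^esub>"
    using add[OF T4 T2 refl, of 6] by (auto dest: point_add_eq_one_imp_same_x simp: quad_simps)
qed

private lemma ord_T18: "MW.ord T18 = 18"
proof (rule MW.ord_eqI[OF carrier_18(2)])
  show "T18 [^]\<^bsub>MW\<^esub> (18::nat) = \<one>\<^bsub>MW\<^esub>"
    by (rule MW.nat_pow_add_eq[OF carrier_18(2) T18_powers(1) T18_powers(1) two_torsion_point_double]) simp
  have "prime_factors (18::nat) = {2, 3}"
    using prime_factors_product[of 2 "3 * 3::nat"] prime_factors_product[of 3 "3::nat"]
    by (simp add: prime_prime_factors insert_commute)
  then show "T18 [^]\<^bsub>MW\<^esub> (18 div q) \<noteq> \<one>\<^bsub>MW\<^esub>" if "q \<in> prime_factors 18" for q :: nat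
    using that T18_powers by (auto simp: one_MW)
qed simp

private lemma not_square_Q18: "Q18 \<notin> MW.squares"
proof (rule not_square_if_halving_quartic_rootless)
  interpret split_prime 26521 71 31 by unfold_locales (simp_all add: cong_def)
  have "reduces a18 50" "reduces b18 17" "reduces 0 0" "reduces (quad 190580690 (- 990806)) 45"
    using reduces_quad_cong[of "- 2522790002" 19969314 50]
      reduces_quad_cong[of 4168469879014423688 "- 25596539667315992" 17]
      reduces_quad_cong[of 190580690 "- 990806" 45]
    by (simp_all add: cong_def reduces_0_iff)
  note quartic = reduces_halving_quartic[OF this]
  have "list_all (\<lambda>r. \<not> 71 dvd monic_poly (halving_quartic 50 17 0 45) r) [0..71 - 1::int]" by code_simp
  then show "monic_poly (halving_quartic a18 b18 0 (quad 190580690 (- 990806))) z \<noteq> 0" if "z \<in> K" for z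
    using monic_poly_rootless[OF quartic] that by blast
qed

private lemma two_torsion_18:
  assumes "P \<in> carrier MW" "P \<otimes>\<^bsub>MW\<^esub> P = \<one>\<^bsub>MW\<^esub>"
  shows "P \<in> {\<one>\<^bsub>MW\<^esub>, Affine 0 0}"
proof (cases "P = \<one>\<^bsub>MW\<^esub>")
  case False
  with assms obtain x where x: "P = Affine x 0" "x \<in> K" "x ^ 3 + a18 * x\<^sup>2 + b18 * x + 0 = 0"
    using two_torsion_point by blast
  interpret split_prime 26521 13 1 by unfold_locales (simp_all add: cong_def)
  have "list_all2 reduces [b18, a18] [6, 9]"
    using reduces_quad_cong[of 4168469879014423688 "- 25596539667315992" 6]
      reduces_quad_cong[of "- 2522790002" 19969314 9]
    by (simp add: cong_def)
  moreover have "list_all (\<lambda>r. \<not> 13 dvd monic_poly [6, 9] r) [0..13 - 1::int]" by code_simp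
  ultimately have "monic_poly [b18, a18] x \<noteq> 0" using x(2) by (rule monic_poly_rootless)
  moreover have "x * monic_poly [b18, a18] x = 0"
    using x(3) by (simp add: power2_eq_square power3_eq_cube algebra_simps)
  ultimately show ?thesis using x(1) by simp
qed simp

private lemma independent_18: "MW.independent_mod_squares ([T18] @ [P18, Q18])"
proof (rule MW.independent_mod_squares_if_separated)
  let ?gs = "[T18] @ [P18, Q18]"
    and ?ds = "[(1, 1432571522, - 8796518), (1, 141523202, - 2308838), (1, 190580690, - 990806)]"
  show carrier: "set ?gs \<subseteq> carrier MW" using carrier_18(1) by simp
  have kummer: "kummer_values 0 ?gs ?ds"
    unfolding kummer_values_def by (simp add: quad_simps zero_closed)
  fix k assume "k < length ?gs"
  then consider (T18) "k = 0" | (P18) "k = 1" | (Q18) "k = 2" by fastforce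
  then show "\<exists>N. subgroup N MW \<and> MW.squares \<subseteq> N \<and> ?gs ! k \<notin> N \<and> (\<forall>i<length ?gs. k < i \<longrightarrow> ?gs ! i \<in> N)"
  proof cases
    case T18
    have "split_prime 26521 13 1" by unfold_locales (simp_all add: cong_def)
    moreover have "legendre_symbols 13 1 (drop 0 ?ds) = [- 1, 1, 1]"
      by (subst legendre_symbols_code, simp, code_simp)
    ultimately show ?thesis unfolding T18 by (intro separating_subgroup[OF _ carrier kummer]) simp_all
  next
    case P18
    have "split_prime 26521 71 40" by unfold_locales (simp_all add: cong_def)
    moreover have "legendre_symbols 71 40 (drop 1 ?ds) = [- 1, 1]"
      by (subst legendre_symbols_code, simp, code_simp)
    ultimately show ?thesis unfolding P18 by (intro separating_subgroup[OF _ carrier kummer]) simp_all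
  next
    case Q18
    then show ?thesis using not_square_Q18 MW.subgroup_squares by (intro exI[of _ MW.squares]) simp
  qed
qed

theorem torsion_18_rank_2:
  "\<exists>K E. quadratic_number_field K \<and> elliptic_curve_over K E \<and>
     has_subgroup_isomorphic_to (mordell_weil_group E K) (integer_mod_group 18 \<times>\<times> free_abelian_group_of_rank 2)"
proof -
  have comb: "MW.combination [T18] c = T18 [^]\<^bsub>MW\<^esub> c 0" for c
    using MW.combination_snoc[of "[]" T18 c] carrier_18(2) by simp
  have two_torsion: "\<exists>c. P = MW.combination [T18] c" if "P \<in> carrier MW" "P \<otimes>\<^bsub>MW\<^esub> P = \<one>\<^bsub>MW\<^esub>" for P
    using two_torsion_18[OF that]
  proof safe
    show "\<exists>c. \<one>\<^bsub>MW\<^esub> = MW.combination [T18] c" by (intro exI[of _ "\<lambda>_. 0"]) (simp add: comb)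
    have "Affine 0 0 = T18 [^]\<^bsub>MW\<^esub> int 9" unfolding int_pow_int T18_powers(1) ..
    then show "\<exists>c. Affine 0 0 = MW.combination [T18] c" by (intro exI[of _ "\<lambda>_. int 9"]) (simp only: comb)
  qed
  have "has_subgroup_isomorphic_to MW (integer_mod_group 18 \<times>\<times> free_abelian_group_of_rank (length [P18, Q18]))"
    by (rule MW.has_subgroup_isomorphic_to_cyclic_times_free
        [OF _ _ independent_18 two_torsion carrier_18(2) ord_T18])
      (use carrier_18 in simp_all)
  then show ?thesis using quadratic_number_field elliptic_curve_over by (auto simp: numeral_2_eq_2)
qed

end

context
begin

interpretation quadratic 55325286553
proof
  show "u\<^sup>2 \<noteq> 55325286553" for u :: int by (rule not_square_if_between_squares[of 235213]) simp_all
qed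

private abbreviation "a10 \<equiv> quad 290781426181610857 0"
private abbreviation "b10 \<equiv> quad (- 34439004478440467537992443684716544) 0"
private abbreviation "root10 \<equiv> quad (- 290781426181610857/2) (2004552903125/2)"
private abbreviation "root10' \<equiv> quad (- 290781426181610857/2) (- 2004552903125/2)"

interpretation quadratic_descent 55325286553 a10 b10 0
proof unfold_locales
  show "discriminant (Weierstrass 0 a10 0 b10 0) \<noteq> 0"
    by (simp add: discriminant_def Let_def quad_simps)
qed (simp_all add: zero_closed)

private abbreviation "S10 \<equiv> Affine root10 0"
private abbreviation "T10 \<equiv> Affine (quad (- 70049056694718816) 0) (quad (- 59122964193080555565626400) 0)"
private abbreviation "points10 \<equiv>
  [Affine (quad 184643872027152384 0) (quad 99246634505744847475200000 0),
   Affine (quad 107498575576623456 0) (quad 30005955604816776958904352 0),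
   Affine (quad (- 146473700982276096) 0) (quad (- 90224525710605308271575040) 0),
   Affine (quad (- 15944056059698814288384/117649) 0) (quad (- 3499098553256696565858225831974400/40353607) 0)]"

private lemma carrier_10: "set ([S10, T10] @ points10) \<subseteq> carrier MW" "T10 \<in> carrier MW"
  unfolding carrier_MW by (simp_all add: zero_closed quad_simps)

private lemma T10_powers:
  "T10 [^]\<^bsub>MW\<^esub> (5::nat) = Affine 0 0"
  "T10 [^]\<^bsub>MW\<^esub> (2::nat) \<noteq> \<one>\<^bsub>MW\<^esub>"
proof -
  let ?T2 = "Affine (quad 110719985698992384 0) (quad (- 33299935298855763801120000) 0)"
    and ?T4 = "Affine (quad 491641231209283584 0) (quad 414956150449060531687833600 0)"
  note add = MW.nat_pow_add_eq[OF carrier_10(2)]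
  have T1: "T10 [^]\<^bsub>MW\<^esub> (1::nat) = T10" using carrier_10 by simp
  have T2: "T10 [^]\<^bsub>MW\<^esub> (2::nat) = ?T2"
    by (rule add[OF T1 T1 point_double_eqI[of _ "quad 511276147 0"]]) (simp_all add: quad_simps)
  have T4: "T10 [^]\<^bsub>MW\<^esub> (4::nat) = ?T4"
    by (rule add[OF T2 T2 point_double_eqI[of _ "quad (- 1001929453) 0"]]) (simp_all add: quad_simps)
  show "T10 [^]\<^bsub>MW\<^esub> (5::nat) = Affine 0 0"
    by (rule add[OF T4 T1 point_add_eqI[of _ _ "quad 844022275 0"]]) (simp_all add: quad_simps)
  show "T10 [^]\<^bsub>MW\<^esub> (2::nat) \<noteq> \<one>\<^bsub>MW\<^esub>" unfolding T2 by (simp add: one_MW)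
qed

private lemma ord_T10: "MW.ord T10 = 10"
proof (rule MW.ord_eqI[OF carrier_10(2)])
  show "T10 [^]\<^bsub>MW\<^esub> (10::nat) = \<one>\<^bsub>MW\<^esub>"
    by (rule MW.nat_pow_add_eq[OF carrier_10(2) T10_powers(1) T10_powers(1) two_torsion_point_double]) simp
  have "prime_factors (10::nat) = {2, 5}"
    using prime_factors_product[of 2 "5::nat"]
    by (simp add: prime_prime_factors insert_commute)
  then show "T10 [^]\<^bsub>MW\<^esub> (10 div q) \<noteq> \<one>\<^bsub>MW\<^esub>" if "q \<in> prime_factors 10" for q :: nat
    using that T10_powers by (auto simp: one_MW)
qed simp

private abbreviation "kummer10_at_0 \<equiv>
  [(2, - 581562852363221714, 4009105806250),
   (1, - 70049056694718816, 0),
   (1, 184643872027152384, 0),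
   (1, 107498575576623456, 0),
   (1, - 146473700982276096, 0),
   (343, - 15944056059698814288384, 0)]"

private abbreviation "kummer10_at_root \<equiv>
  [(2, 444619711451946948272072884238281250, - 1165773504054351853776738456250),
   (2, 301366625584346450, - 4009105806250),
   (2, 1320138340471831250, - 4009105806250),
   (2, 1011557154669715538, - 4009105806250),
   (2, - 4331951565882670, - 4009105806250),
   (235298, 546369459522090104257125650, - 55491184883502910806250)]"

private lemma kummer_values_10:
  "kummer_values 0 ([S10, T10] @ points10) kummer10_at_0"
  "kummer_values root10 ([S10, T10] @ points10) kummer10_at_root"
  unfolding kummer_values_def by (simp_all add: quad_simps zero_closed)

private lemma legendre_symbols_10:
  "legendre_symbols 239 25 (drop 0 kummer10_at_0) = [- 1, 1, 1, 1, 1, 1]"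
  "legendre_symbols 191 72 (drop 1 kummer10_at_root) = [- 1, 1, 1, 1, 1]"
  "legendre_symbols 103 91 (drop 2 kummer10_at_0) = [- 1, 1, 1, 1]"
  "legendre_symbols 631 211 (drop 3 kummer10_at_root) = [- 1, 1, 1]"
  "legendre_symbols 29 16 (drop 4 kummer10_at_root) = [- 1, 1]"
  "legendre_symbols 157 87 (drop 5 kummer10_at_0) = [- 1]"
  by (subst legendre_symbols_code, simp, code_simp)+

private lemma split_primes_10:
  "split_prime 55325286553 239 25"
  "split_prime 55325286553 191 72"
  "split_prime 55325286553 103 91"
  "split_prime 55325286553 631 211"
  "split_prime 55325286553 29 16"
  "split_prime 55325286553 157 87"
  by unfold_locales (simp_all add: cong_def)

private lemma independent_10: "MW.independent_mod_squares ([S10, T10] @ points10)"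
proof (rule MW.independent_mod_squares_if_separated[OF carrier_10(1)])
  note separated = separating_subgroup[OF _ carrier_10(1)]
  let ?gs = "[S10, T10] @ points10"
  fix k assume "k < length ?gs"
  then consider (S10) "k = 0" | (T10) "k = 1"
    | (first) "k = 2" | (second) "k = 3" | (third) "k = 4" | (fourth) "k = 5" by fastforce
  then show "\<exists>N. subgroup N MW \<and> MW.squares \<subseteq> N \<and> ?gs ! k \<notin> N \<and> (\<forall>i<length ?gs. k < i \<longrightarrow> ?gs ! i \<in> N)"
  proof cases
    case S10
    show ?thesis unfolding S10
      by (rule separated[OF split_primes_10(1) kummer_values_10(1)]) (use legendre_symbols_10(1) in simp_all)
  next
    case T10
    show ?thesis unfolding T10
      by (rule separated[OF split_primes_10(2) kummer_values_10(2)]) (use legendre_symbols_10(2) in simp_all)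
  next
    case first
    show ?thesis unfolding first
      by (rule separated[OF split_primes_10(3) kummer_values_10(1)]) (use legendre_symbols_10(3) in simp_all)
  next
    case second
    show ?thesis unfolding second
      by (rule separated[OF split_primes_10(4) kummer_values_10(2)]) (use legendre_symbols_10(4) in simp_all)
  next
    case third
    show ?thesis unfolding third
      by (rule separated[OF split_primes_10(5) kummer_values_10(2)]) (use legendre_symbols_10(5) in simp_all)
  next
    case fourth
    show ?thesis unfolding fourth
      by (rule separated[OF split_primes_10(6) kummer_values_10(1)]) (use legendre_symbols_10(6) in simp_all)
  qed
qed

theorem torsion_2_10_rank_4:
  "\<exists>K E. quadratic_number_field K \<and> elliptic_curve_over K E \<and>
     has_subgroup_isomorphic_to (mordell_weil_group E K)
       (integer_mod_group 2 \<times>\<times> integer_mod_group 10 \<times>\<times> free_abelian_group_of_rank 4)"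
proof -
  have length: "length points10 = 4" by simp
  have "has_subgroup_isomorphic_to MW
      (integer_mod_group 2 \<times>\<times> integer_mod_group (2 * 5) \<times>\<times> free_abelian_group_of_rank (length points10))"
  proof (rule has_subgroup_if_full_two_torsion[OF _ _ _ _ _ _ T10_powers(1) carrier_10(1) independent_10])
    show "MW.ord T10 = 2 * 5" using ord_T10 by simp
    show "a10 = - (root10 + 0 + root10')"
      "b10 = root10 * 0 + root10 * root10' + 0 * root10'"
      "0 = - (root10 * 0 * root10')" "root10 \<noteq> 0"
      by (simp_all add: quad_simps)
  qed simp
  then have "has_subgroup_isomorphic_to MW
      (integer_mod_group 2 \<times>\<times> integer_mod_group 10 \<times>\<times> free_abelian_group_of_rank 4)"
    unfolding length by simp
  then show ?thesis using quadratic_number_field elliptic_curve_over by blast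
qed

end

context
begin

interpretation quadratic 18249
proof
  show "u\<^sup>2 \<noteq> 18249" for u :: int by (rule not_square_if_between_squares[of 135]) simp_all
qed

private abbreviation "a12 \<equiv> quad 11459246881 0"
private abbreviation "b12 \<equiv> quad (- 19643578253312000000) 0"
private abbreviation "root12 \<equiv> quad (- 12973390625) 0"
private abbreviation "root12' \<equiv> quad 1514143744 0"

interpretation quadratic_descent 18249 a12 b12 0
proof unfold_locales
  show "discriminant (Weierstrass 0 a12 0 b12 0) \<noteq> 0"
    by (simp add: discriminant_def Let_def quad_simps)
qed (simp_all add: zero_closed)

private abbreviation "S12 \<equiv> Affine root12 0"
private abbreviation "T12 \<equiv> Affine (quad (- 4527297200) 46899600) (quad (- 310681100545200) 1643408883600)"
private abbreviation "points12 \<equiv>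
  [Affine (quad 1945600000 0) (quad 111908966400000 0),
   Affine (quad (- 107494400) 0) (quad 47357625369600 0),
   Affine (quad (- 124891696800/11) 0) (quad 0 (435707041442400/121)),
   Affine (quad (- 1993441974860720/312481) (14260429362960/312481))
     (quad (18017710257187688659920/174676879) (- 222307416246842728560/174676879))]"

private lemma carrier_12: "set ([S12, T12] @ points12) \<subseteq> carrier MW" "T12 \<in> carrier MW"
  unfolding carrier_MW by (simp_all add: zero_closed quad_simps)

private lemma T12_powers:
  "T12 [^]\<^bsub>MW\<^esub> (6::nat) = Affine root12' 0"
  "T12 [^]\<^bsub>MW\<^esub> (4::nat) \<noteq> \<one>\<^bsub>MW\<^esub>"
proof -
  let ?T2 = "Affine (quad 16692640000 0) (quad 2741615886240000 0)"
    and ?T4 = "Affine (quad 2959360000 0) (quad 261042186240000 0)"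
  note add = MW.nat_pow_add_eq[OF carrier_12(2)]
  have T1: "T12 [^]\<^bsub>MW\<^esub> (1::nat) = T12" using carrier_12 by simp
  have T2: "T12 [^]\<^bsub>MW\<^esub> (2::nat) = ?T2"
    by (rule add[OF T1 T1 point_double_eqI[of _ "quad (- 129200) (- 363)"]]) (simp_all add: quad_simps)
  have T4: "T12 [^]\<^bsub>MW\<^esub> (4::nat) = ?T4"
    by (rule add[OF T2 T2 point_double_eqI[of _ "quad 218641 0"]]) (simp_all add: quad_simps)
  show "T12 [^]\<^bsub>MW\<^esub> (6::nat) = Affine root12' 0"
    by (rule add[OF T4 T2 point_add_eqI[of _ _ "quad 180625 0"]]) (simp_all add: quad_simps)
  show "T12 [^]\<^bsub>MW\<^esub> (4::nat) \<noteq> \<one>\<^bsub>MW\<^esub>" unfolding T4 by (simp add: one_MW)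
qed

private lemma ord_T12: "MW.ord T12 = 12"
proof (rule MW.ord_eqI[OF carrier_12(2)])
  show "T12 [^]\<^bsub>MW\<^esub> (12::nat) = \<one>\<^bsub>MW\<^esub>"
    by (rule MW.nat_pow_add_eq[OF carrier_12(2) T12_powers(1) T12_powers(1) two_torsion_point_double]) simp
  have "prime_factors (12::nat) = {2, 3}"
    using prime_factors_product[of 2 "2 * 3::nat"] prime_factors_product[of 2 "3::nat"]
    by (simp add: prime_prime_factors insert_commute)
  then show "T12 [^]\<^bsub>MW\<^esub> (12 div q) \<noteq> \<one>\<^bsub>MW\<^esub>" if "q \<in> prime_factors 12" for q :: nat
    using that T12_powers by (auto simp: one_MW)
qed simp

private abbreviation "kummer12_at_0 \<equiv>
  [(1, - 12973390625, 0),
   (1, - 4527297200, 46899600),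
   (1, 1945600000, 0),
   (1, - 107494400, 0),
   (11, - 1373808664800, 0),
   (559, - 1993441974860720, 14260429362960)]"

private abbreviation "kummer12_at_root \<equiv>
  [(1, 187952442562149890625, 0),
   (1, 8446093425, 46899600),
   (1, 14918990625, 0),
   (1, 12865896225, 0),
   (11, 195971600825, 0),
   (559, 2060496101029905, 14260429362960)]"

private lemma kummer_values_12:
  "kummer_values 0 ([S12, T12] @ points12) kummer12_at_0"
  "kummer_values root12 ([S12, T12] @ points12) kummer12_at_root"
  unfolding kummer_values_def by (simp_all add: quad_simps zero_closed)

private lemma legendre_symbols_12:
  "legendre_symbols 113 100 (drop 0 kummer12_at_0) = [- 1, 1, 1, 1, 1, 1]"
  "legendre_symbols 127 71 (drop 1 kummer12_at_root) = [- 1, 1, 1, 1, 1]"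
  "legendre_symbols 229 171 (drop 2 kummer12_at_root) = [- 1, 1, 1, 1]"
  "legendre_symbols 257 60 (drop 3 kummer12_at_0) = [- 1, 1, 1]"
  "legendre_symbols 157 115 (drop 4 kummer12_at_0) = [- 1, 1]"
  "legendre_symbols 373 128 (drop 5 kummer12_at_root) = [- 1]"
  by (subst legendre_symbols_code, simp, code_simp)+

private lemma split_primes_12:
  "split_prime 18249 113 100"
  "split_prime 18249 127 71"
  "split_prime 18249 229 171"
  "split_prime 18249 257 60"
  "split_prime 18249 157 115"
  "split_prime 18249 373 128"
  by unfold_locales (simp_all add: cong_def)

private lemma independent_12: "MW.independent_mod_squares ([S12, T12] @ points12)"
proof (rule MW.independent_mod_squares_if_separated[OF carrier_12(1)])
  note separated = separating_subgroup[OF _ carrier_12(1)]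
  let ?gs = "[S12, T12] @ points12"
  fix k assume "k < length ?gs"
  then consider (S12) "k = 0" | (T12) "k = 1"
    | (first) "k = 2" | (second) "k = 3" | (third) "k = 4" | (fourth) "k = 5" by fastforce
  then show "\<exists>N. subgroup N MW \<and> MW.squares \<subseteq> N \<and> ?gs ! k \<notin> N \<and> (\<forall>i<length ?gs. k < i \<longrightarrow> ?gs ! i \<in> N)"
  proof cases
    case S12
    show ?thesis unfolding S12
      by (rule separated[OF split_primes_12(1) kummer_values_12(1)]) (use legendre_symbols_12(1) in simp_all)
  next
    case T12
    show ?thesis unfolding T12
      by (rule separated[OF split_primes_12(2) kummer_values_12(2)]) (use legendre_symbols_12(2) in simp_all)
  next
    case first
    show ?thesis unfolding first
      by (rule separated[OF split_primes_12(3) kummer_values_12(2)]) (use legendre_symbols_12(3) in simp_all)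
  next
    case second
    show ?thesis unfolding second
      by (rule separated[OF split_primes_12(4) kummer_values_12(1)]) (use legendre_symbols_12(4) in simp_all)
  next
    case third
    show ?thesis unfolding third
      by (rule separated[OF split_primes_12(5) kummer_values_12(1)]) (use legendre_symbols_12(5) in simp_all)
  next
    case fourth
    show ?thesis unfolding fourth
      by (rule separated[OF split_primes_12(6) kummer_values_12(2)]) (use legendre_symbols_12(6) in simp_all)
  qed
qed

theorem torsion_2_12_rank_4:
  "\<exists>K E. quadratic_number_field K \<and> elliptic_curve_over K E \<and>
     has_subgroup_isomorphic_to (mordell_weil_group E K)
       (integer_mod_group 2 \<times>\<times> integer_mod_group 12 \<times>\<times> free_abelian_group_of_rank 4)"
proof -
  have length: "length points12 = 4" by simp
  have "has_subgroup_isomorphic_to MW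
      (integer_mod_group 2 \<times>\<times> integer_mod_group (2 * 6) \<times>\<times> free_abelian_group_of_rank (length points12))"
  proof (rule has_subgroup_if_full_two_torsion[OF _ _ _ _ _ _ T12_powers(1) carrier_12(1) independent_12])
    show "MW.ord T12 = 2 * 6" using ord_T12 by simp
    show "a12 = - (root12 + root12' + 0)"
      "b12 = root12 * root12' + root12 * 0 + root12' * 0"
      "0 = - (root12 * root12' * 0)" "root12 \<noteq> root12'"
      by (simp_all add: quad_simps)
  qed simp
  then have "has_subgroup_isomorphic_to MW
      (integer_mod_group 2 \<times>\<times> integer_mod_group 12 \<times>\<times> free_abelian_group_of_rank 4)"
    unfolding length by simp
  then show ?thesis using quadratic_number_field elliptic_curve_over by blast
qed

end

theorem theorem3p2:
  shows
    "(\<exists>K E. quadratic_number_field K \<and> elliptic_curve_over K E \<and>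
        has_subgroup_isomorphic_to (mordell_weil_group E K)
          (integer_mod_group 15 \<times>\<times> integer_group)) \<and>
     (\<exists>K E. quadratic_number_field K \<and> elliptic_curve_over K E \<and>
        has_subgroup_isomorphic_to (mordell_weil_group E K)
          (integer_mod_group 18 \<times>\<times> free_abelian_group_of_rank 2)) \<and>
     (\<exists>K E. quadratic_number_field K \<and> elliptic_curve_over K E \<and>
        has_subgroup_isomorphic_to (mordell_weil_group E K)
          (integer_mod_group 2 \<times>\<times> integer_mod_group 10 \<times>\<times> free_abelian_group_of_rank 4)) \<and>
     (\<exists>K E. quadratic_number_field K \<and> elliptic_curve_over K E \<and>
        has_subgroup_isomorphic_to (mordell_weil_group E K)
          (integer_mod_group 2 \<times>\<times> integer_mod_group 12 \<times>\<times> free_abelian_group_of_rank 4))"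
  by (intro conjI torsion_15_rank_1 torsion_18_rank_2 torsion_2_10_rank_4 torsion_2_12_rank_4)

end
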